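(* Let $G$ be a locally compact abelian group, let $\mu\in\mathcal{WAP}(G)$ and $\chi\in\widehat{G}$. Then the Fourier–Bohr coefficient $c_\chi:\mathbb{X}(\mu)\to\mathbb{C}$, $\nu\mapsto c_\chi(\nu)$, is continuous and satisfies $$c_\chi(T^t\nu)=\chi(t)\,c_\chi(\nu)\qquad\text{for all } t\in G,\ \nu\in\mathbb{X}(\mu).$$ In particular, if $c_\chi(\mu)\neq 0$, then $c_\chi$ is a continuous eigenfunction of $\mathbb{X}(\mu)$.
   Context: $C_c(G)$: continuous compactly supported functions on $G$; $C_u(G)$: Banach space of bounded uniformly continuous complex functions, sup norm. $\theta_G$ (also $dt$) is Haar measure. Measures are (complex) Radon measures on $G$; the vague topology is the weak-* topology of the duality with $C_c(G)$. $\mu$ is translation bounded if $\sup_{x\in G}|\mu|(x+K)<\infty$ for all compact $K$ ($|\mu|$ the variation). $(c*\mu)(x)=\int_G c(x-t)\,d\mu(t)$; $T^tf(x)=f(x-t)$, $T^t\mu=\delta_t*\mu$, with $\delta_t$ the unit point mass at $t$. The hull $\mathbb{X}(\mu)$ is the vague closure of $\{T^t\mu:t\in G\}$, a compact space with continuous $G$-action, carrying the vague topology. $f\in C_u(G)$ is weakly almost periodic if $\{T^tf:t\in G\}$ is precompact in the weak topology of $C_u(G)$. $\mathcal{WAP}(G)$ is the set of translation bounded measures $\mu$ such that $c*\mu$ is a weakly almost periodic function for all $c\in C_c(G)$; if $\mu\in\mathcal{WAP}(G)$ then $\mathbb{X}(\mu)\subset\mathcal{WAP}(G)$. $G$ is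 assumed to admit Følner sequences: sequences $(A_n)$ of compact sets of positive measure with $\theta_G(A_n\triangle(x+A_n))/\theta_G(A_n)\to0$ for all $x\in G$. Every weakly almost periodic function $f$ has a mean $M(f)=\lim_n\frac1{\theta_G(A_n)}\int_{x+A_n}f(t)\,dt$, uniformly in $x\in G$, independent of the Følner sequence. For $\mu\in\mathcal{WAP}(G)$ the mean $M(\mu)$ is the unique constant with $M(c*\mu)=M(\mu)\int_Gc(t)\,dt$ for all $c\in C_c(G)$. For $\chi\in\widehat G$ (the dual group), $\overline{\chi}\mu\in\mathcal{WAP}(G)$ and $c_\chi(\mu):=M(\overline{\chi}\mu)$. A continuous eigenfunction of a dynamical system $(\mathbb{X},T)$ is a function $0\ne f\in C(\mathbb{X})$ for which there is $\xi\in\widehat G$ with $f(T^tx)=\xi(t)f(x)$ for all $t\in G$, $x\in\mathbb{X}$.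
   Formalization: The factor χ(t) in the displayed formula is replaced by its complex conjugate: with T^tν=δ_t*ν and c_χ(ν)=M(χ̄ν) the printed formula fails, e.g. for μ=χθ on ℝ with χ(x)=e^{ix}, where c_χ(T^tμ) is the conjugate of χ(t). *)

theory Defs
  imports "HOL-Analysis.Analysis"
begin

section \<open>Function spaces on a topological group\<close>

definition sup_norm :: "('a \<Rightarrow> complex) \<Rightarrow> real" where
  "sup_norm f = (SUP x. norm (f x))"

definition supp :: "('a::topological_space \<Rightarrow> complex) \<Rightarrow> 'a set" where
  "supp f = closure {x. f x \<noteq> 0}"

definition Cc :: "('a::topological_space \<Rightarrow> complex) set" where
  "Cc = {f. continuous_on UNIV f \<and> compact (supp f)}"

text \<open>Uniform continuity refers to the group uniformity, which need not be metrizable.\<close>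

definition Cu :: "('a::topological_ab_group_add \<Rightarrow> complex) set" where
  "Cu = {f. bounded (range f) \<and>
            (\<forall>e>0. \<exists>U. open U \<and> 0 \<in> U \<and> (\<forall>x y. x - y \<in> U \<longrightarrow> dist (f x) (f y) < e))}"

definition translate_fun :: "'a::ab_group_add \<Rightarrow> ('a \<Rightarrow> complex) \<Rightarrow> 'a \<Rightarrow> complex" where
  "translate_fun t f = (\<lambda>x. f (x - t))"

definition dual_group :: "('a::topological_ab_group_add \<Rightarrow> complex) set" where
  "dual_group = {\<xi>. continuous_on UNIV \<xi> \<and> (\<forall>x. norm (\<xi> x) = 1) \<and>
                     (\<forall>x y. \<xi> (x + y) = \<xi> x * \<xi> y)}"


section \<open>Weakly almost periodic functions\<close>

text \<open>The topological dual of the complex Banach space \<open>Cu\<close>. Only the values on \<open>Cu\<close> matter.\<close>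

definition Cu_dual :: "(('a::topological_ab_group_add \<Rightarrow> complex) \<Rightarrow> complex) set" where
  "Cu_dual = {\<phi>.
     (\<forall>f\<in>Cu. \<forall>g\<in>Cu. \<phi> (\<lambda>x. f x + g x) = \<phi> f + \<phi> g) \<and>
     (\<forall>a. \<forall>f\<in>Cu. \<phi> (\<lambda>x. a * f x) = a * \<phi> f) \<and>
     (\<exists>B. \<forall>f\<in>Cu. norm (\<phi> f) \<le> B * sup_norm f)}"

definition Cu_weak :: "('a::topological_ab_group_add \<Rightarrow> complex) topology" where
  "Cu_weak = topology_generated_by {{f \<in> Cu. \<phi> f \<in> U} |\<phi> U. \<phi> \<in> Cu_dual \<and> open U}"

definition wap_fun :: "('a::topological_ab_group_add \<Rightarrow> complex) \<Rightarrow> bool" where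
  "wap_fun f \<longleftrightarrow> f \<in> Cu \<and>
     compactin Cu_weak (Cu_weak closure_of (range (\<lambda>t. translate_fun t f)))"


section \<open>Complex Radon measures\<close>

text \<open>
  A complex Radon measure is a linear functional on \<open>Cc\<close> that is continuous for the inductive
  limit topology, i.e. sup-norm bounded on the functions supported in any fixed compact set; it
  need not be representable by a complex-valued set function on all Borel sets, as it may be
  unbounded. Functionals are kept extensional, so that equality of measures is equality of
  functions and the vague topology is a subspace of a product topology.
\<close>

definition radon_measures :: "(('a::topological_space \<Rightarrow> complex) \<Rightarrow> complex) set" where
  "radon_measures = {\<mu> \<in> extensional Cc.
     (\<forall>f\<in>Cc. \<forall>g\<in>Cc. \<mu> (\<lambda>x. f x + g x) = \<mu> f + \<mu> g) \<and>
     (\<forall>a. \<forall>f\<in>Cc. \<mu> (\<lambda>x. a * f x) = a * \<mu> f) \<and>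
     (\<forall>K. compact K \<longrightarrow> (\<exists>B. \<forall>f\<in>Cc. supp f \<subseteq> K \<longrightarrow> norm (\<mu> f) \<le> B * sup_norm f))}"

definition vague_topology :: "(('a::topological_space \<Rightarrow> complex) \<Rightarrow> complex) topology" where
  "vague_topology = subtopology (product_topology (\<lambda>_. euclidean) Cc) radon_measures"

text \<open>
  The value on \<open>A\<close> of the positive Radon (outer regular) measure that represents the variation,
  by the formula from the Riesz representation theorem: first on open sets, then from outside.
\<close>

definition variation ::
    "(('a::topological_space \<Rightarrow> complex) \<Rightarrow> complex) \<Rightarrow> 'a set \<Rightarrow> ennreal" where
  "variation \<mu> A = (INF U\<in>{U. open U \<and> A \<subseteq> U}.
     SUP g\<in>{g \<in> Cc. supp g \<subseteq> U \<and> (\<forall>x. norm (g x) \<le> 1)}. ennreal (norm (\<mu> g)))"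

definition translation_bounded ::
    "(('a::topological_ab_group_add \<Rightarrow> complex) \<Rightarrow> complex) \<Rightarrow> bool" where
  "translation_bounded \<mu> \<longleftrightarrow>
     (\<forall>K. compact K \<longrightarrow> (SUP x. variation \<mu> ((+) x ` K)) < \<infinity>)"

definition conv ::
    "('a::ab_group_add \<Rightarrow> complex) \<Rightarrow> (('a \<Rightarrow> complex) \<Rightarrow> complex) \<Rightarrow> 'a \<Rightarrow> complex" where
  "conv c \<mu> = (\<lambda>x. \<mu> (\<lambda>t. c (x - t)))"

text \<open>The convolution of the unit point mass at \<open>t\<close> with \<open>\<mu>\<close>.\<close>

definition translate_meas ::
    "'a::topological_ab_group_add \<Rightarrow> (('a \<Rightarrow> complex) \<Rightarrow> complex) \<Rightarrow> ('a \<Rightarrow> complex) \<Rightarrow> complex" where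
  "translate_meas t \<mu> = (\<lambda>f\<in>Cc. \<mu> (\<lambda>s. f (t + s)))"

definition times_meas ::
    "('a::topological_space \<Rightarrow> complex) \<Rightarrow> (('a \<Rightarrow> complex) \<Rightarrow> complex) \<Rightarrow> ('a \<Rightarrow> complex) \<Rightarrow> complex" where
  "times_meas h \<mu> = (\<lambda>f\<in>Cc. \<mu> (\<lambda>s. h s * f s))"

definition measure_hull ::
    "(('a::topological_ab_group_add \<Rightarrow> complex) \<Rightarrow> complex) \<Rightarrow> (('a \<Rightarrow> complex) \<Rightarrow> complex) set" where
  "measure_hull \<mu> = vague_topology closure_of (range (\<lambda>t. translate_meas t \<mu>))"

definition WAP :: "(('a::topological_ab_group_add \<Rightarrow> complex) \<Rightarrow> complex) set" where
  "WAP = {\<mu> \<in> radon_measures. translation_bounded \<mu> \<and> (\<forall>c\<in>Cc. wap_fun (conv c \<mu>))}"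


section \<open>Haar measure, means and Fourier--Bohr coefficients\<close>

definition haar_measure :: "'a::topological_ab_group_add measure \<Rightarrow> bool" where
  "haar_measure \<theta> \<longleftrightarrow>
     sets \<theta> = sets borel \<and>
     emeasure \<theta> UNIV \<noteq> 0 \<and>
     (\<forall>K. compact K \<longrightarrow> emeasure \<theta> K < \<infinity>) \<and>
     (\<forall>B\<in>sets borel. emeasure \<theta> B = (INF U\<in>{U. open U \<and> B \<subseteq> U}. emeasure \<theta> U)) \<and>
     (\<forall>U. open U \<longrightarrow> emeasure \<theta> U = (SUP K\<in>{K. compact K \<and> K \<subseteq> U}. emeasure \<theta> K)) \<and>
     (\<forall>x. \<forall>B\<in>sets borel. emeasure \<theta> ((+) x ` B) = emeasure \<theta> B)"

definition folner :: "'a::topological_ab_group_add measure \<Rightarrow> (nat \<Rightarrow> 'a set) \<Rightarrow> bool" where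
  "folner \<theta> A \<longleftrightarrow>
     (\<forall>n. compact (A n) \<and> measure \<theta> (A n) > 0) \<and>
     (\<forall>x. (\<lambda>n. measure \<theta> (sym_diff (A n) ((+) x ` A n)) / measure \<theta> (A n)) \<longlonglongrightarrow> 0)"

definition has_mean ::
    "'a::topological_ab_group_add measure \<Rightarrow> ('a \<Rightarrow> complex) \<Rightarrow> complex \<Rightarrow> bool" where
  "has_mean \<theta> f m \<longleftrightarrow> (\<forall>A. folner \<theta> A \<longrightarrow>
     uniform_limit UNIV
       (\<lambda>n x. (LINT t:((+) x ` A n)|\<theta>. f t) / complex_of_real (measure \<theta> (A n)))
       (\<lambda>_. m) sequentially)"

text \<open>The description is unique as soon as there is a Folner sequence.\<close>

definition mean_fun ::
    "'a::topological_ab_group_add measure \<Rightarrow> ('a \<Rightarrow> complex) \<Rightarrow> complex" where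
  "mean_fun \<theta> f = (THE m. has_mean \<theta> f m)"

definition mean_meas ::
    "'a::topological_ab_group_add measure \<Rightarrow> (('a \<Rightarrow> complex) \<Rightarrow> complex) \<Rightarrow> complex" where
  "mean_meas \<theta> \<mu> = (THE m. \<forall>c\<in>Cc. mean_fun \<theta> (conv c \<mu>) = m * (LINT t|\<theta>. c t))"

definition fourier_bohr ::
    "'a::topological_ab_group_add measure \<Rightarrow> ('a \<Rightarrow> complex) \<Rightarrow> (('a \<Rightarrow> complex) \<Rightarrow> complex) \<Rightarrow> complex" where
  "fourier_bohr \<theta> \<xi> \<mu> = mean_meas \<theta> (times_meas (\<lambda>x. cnj (\<xi> x)) \<mu>)"


text \<open>
  With the conventions above, \<open>translate_meas t\<close> shifts the density of \<open>\<xi> \<theta>\<close> to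
  \<open>\<xi> (x - t) = cnj (\<xi> t) * \<xi> x\<close>, so that translating by \<open>t\<close> multiplies the
  coefficient by \<open>cnj (\<xi> t)\<close> and not by \<open>\<xi> t\<close>. The following identity is the source
  of this factor.
\<close>

lemma Cc_translate:
  fixes f :: "'a::topological_ab_group_add \<Rightarrow> complex"
  assumes "f \<in> Cc"
  shows "(\<lambda>s. f (t + s)) \<in> Cc"
proof -
  have cont: "continuous_on UNIV f" and comp: "compact (supp f)"
    using assms by (auto simp: Cc_def)
  have "continuous_on UNIV (\<lambda>s. f (t + s))"
    by (rule continuous_on_compose2[OF cont]) (intro continuous_intros, simp)
  moreover have "compact (supp (\<lambda>s. f (t + s)))"
  proof -
    let ?S = "(\<lambda>x. x - t) ` supp f"
    have eq: "?S = (\<lambda>s. t + s) -` supp f"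
    proof (intro set_eqI iffI)
      fix x assume "x \<in> (\<lambda>s. t + s) -` supp f"
      then show "x \<in> ?S"
        by (intro image_eqI[of _ _ "t + x"]) auto
    qed auto
    have "compact ?S"
      by (rule compact_continuous_image[OF _ comp]) (intro continuous_intros)
    moreover have "closed ?S"
      unfolding eq by (intro closed_vimage continuous_intros) (simp add: supp_def)
    moreover have "{s. f (t + s) \<noteq> 0} \<subseteq> ?S"
      unfolding eq using closure_subset[of "{x. f x \<noteq> 0}"] by (auto simp: supp_def)
    ultimately have sub: "supp (\<lambda>s. f (t + s)) \<subseteq> ?S"
      unfolding supp_def by (metis closure_minimal)
    have "compact (?S \<inter> supp (\<lambda>s. f (t + s)))"
      using \<open>compact ?S\<close> by (rule compact_Int_closed) (simp add: supp_def)
    then show ?thesis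
      using sub by (simp add: Int_absorb1)
  qed
  ultimately show ?thesis
    by (simp add: Cc_def)
qed

lemma Cc_times_character:
  assumes "\<xi> \<in> dual_group" and "f \<in> Cc"
  shows "(\<lambda>s. cnj (\<xi> s) * f s) \<in> Cc"
proof -
  have "\<xi> x \<noteq> 0" for x
  proof -
    have "norm (\<xi> x) = 1"
      using assms(1) by (simp add: dual_group_def)
    then show ?thesis by auto
  qed
  then have "supp (\<lambda>s. cnj (\<xi> s) * f s) = supp f"
    by (simp add: supp_def)
  with assms show ?thesis
    by (auto simp: Cc_def dual_group_def intro!: continuous_intros)
qed

lemma times_cnj_character_translate_meas:
  assumes \<xi>: "\<xi> \<in> dual_group" and \<nu>: "\<nu> \<in> radon_measures" and f: "f \<in> Cc"
  shows "times_meas (\<lambda>x. cnj (\<xi> x)) (translate_meas t \<nu>) f =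
         cnj (\<xi> t) * translate_meas t (times_meas (\<lambda>x. cnj (\<xi> x)) \<nu>) f"
proof -
  have g: "(\<lambda>s. cnj (\<xi> s) * f (t + s)) \<in> Cc"
    using \<xi> f by (intro Cc_times_character Cc_translate)
  have "times_meas (\<lambda>x. cnj (\<xi> x)) (translate_meas t \<nu>) f = \<nu> (\<lambda>s. cnj (\<xi> (t + s)) * f (t + s))"
    using \<xi> f by (simp add: times_meas_def translate_meas_def Cc_times_character)
  also have "\<dots> = \<nu> (\<lambda>s. cnj (\<xi> t) * (cnj (\<xi> s) * f (t + s)))"
    using \<xi> by (simp add: dual_group_def mult.assoc)
  also have "\<dots> = cnj (\<xi> t) * \<nu> (\<lambda>s. cnj (\<xi> s) * f (t + s))"
    using \<nu> g by (simp add: radon_measures_def)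
  finally show ?thesis
    using f by (simp add: times_meas_def translate_meas_def Cc_translate)
qed


section \<open>Eigenfunctions\<close>

definition continuous_eigenfunction ::
    "'x topology \<Rightarrow> ('a::topological_ab_group_add \<Rightarrow> 'x \<Rightarrow> 'x) \<Rightarrow> ('x \<Rightarrow> complex) \<Rightarrow> bool" where
  "continuous_eigenfunction X T f \<longleftrightarrow>
     continuous_map X euclidean f \<and>
     (\<exists>x\<in>topspace X. f x \<noteq> 0) \<and>
     (\<exists>\<xi>\<in>dual_group. \<forall>t. \<forall>x\<in>topspace X. f (T t x) = \<xi> t * f x)"

end

(*
  The averages of a weakly almost periodic function f along Folner sequences all converge to one
  number: let phi be a Folner limit functional and B_n another Folner sequence. By weak continuity
  the averages along B_n converge pointwise on the weak orbit closure of f, which is compact, and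
  bounded convergence on this compact space identifies their limit with phi(f). This replaces the
  Krein-Smulian theorem and the Ryll-Nardzewski fixed point theorem.

  The mean is therefore given by a single weakly continuous phi. For nu in the hull and the twist
  lambda of nu by the conjugate of xi, c |-> phi(c * lambda) is an invariant functional, hence a
  multiple of the Haar integral, and the factor is the Fourier-Bohr coefficient of nu. Since
  c * lambda is the conjugate of xi times (xi c) * nu, and (xi c) * nu stays in a weakly compact
  set, where the weak topology is that of pointwise convergence, it depends continuously on nu.
*)
theory Submission
  imports Defs
begin

text \<open>The means are defined by \<open>THE\<close>, so their existence, their uniqueness and
  the uniformity over all translates must be established before any coefficient can be computed.
  Three obstacles shape the proof. The limit functionals are not given by measures, so Fubini's
  theorem cannot move them under a Haar integral; instead the integral is replaced by finite Riemann
  sums of translates, which are uniformly close by uniform continuity. Nor does an invariant mean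
  obey bounded convergence on a noncompact group: it vanishes on compactly supported functions,
  which may increase to 1. Bounded convergence is recovered only after the mean is transported to a
  compact orbit closure. Finally, the uniformity in x costs nothing extra, because shifting each
  member of a Folner sequence by an arbitrary point gives a Folner sequence again. Weak almost
  periodicity enters the mean theorem as a weakly compact set \<open>K\<close> containing all
  translates of \<open>f\<close>; for a twisted convolution such a set can be written down
  directly.\<close>

section \<open>Bounded continuous and uniformly continuous functions\<close>

text \<open>Larger than \<open>Cu\<close> on purpose: in \<open>mean_unique\<close> the limit
  functional is applied to functions on the group that come from weakly continuous functions on an
  orbit closure, and these are obtained only as bounded and continuous.\<close>

definition bounded_cont :: "('a::topological_space \<Rightarrow> complex) set" where
  "bounded_cont = {u. continuous_on UNIV u \<and> bounded (range u)}"

lemma bounded_cont_add: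
  "u \<in> bounded_cont \<Longrightarrow> v \<in> bounded_cont \<Longrightarrow> (\<lambda>x. u x + v x) \<in> bounded_cont"
  by (auto simp: bounded_cont_def intro!: continuous_on_add bounded_plus_comp)

lemma bounded_cont_scale: "u \<in> bounded_cont \<Longrightarrow> (\<lambda>x. a * u x) \<in> bounded_cont"
  using bounded_linear_image[OF _ bounded_linear_mult_right, of "range u" a]
  by (auto simp: bounded_cont_def image_image intro!: continuous_on_mult continuous_on_const)

lemma bounded_cont_of_real:
  fixes r :: "'a::topological_space \<Rightarrow> real"
  assumes "continuous_on UNIV r" "bounded (range r)"
  shows "(\<lambda>t. complex_of_real (r t)) \<in> bounded_cont"
  using assms by (auto simp: bounded_cont_def bounded_iff intro!: continuous_on_of_real)

lemma bounded_cont_norm: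
  assumes "u \<in> bounded_cont"
  shows "continuous_on UNIV (\<lambda>t. norm (u t))" "bounded (range (\<lambda>t. norm (u t)))"
  using assms by (auto simp: bounded_cont_def bounded_iff intro!: continuous_on_norm)

lemma norm_le_sup_norm: "bounded (range f) \<Longrightarrow> norm (f x) \<le> sup_norm f"
  unfolding sup_norm_def bounded_iff by (rule cSUP_upper) (auto simp: bdd_above_def)

lemma sup_norm_least: "(\<And>x. norm (f x) \<le> B) \<Longrightarrow> sup_norm f \<le> B"
  unfolding sup_norm_def by (rule cSUP_least) auto

lemma sup_norm_nonneg: "bounded (range f) \<Longrightarrow> 0 \<le> sup_norm f"
  using norm_le_sup_norm[of f undefined] norm_ge_zero order_trans by blast

lemma bounded_range_iff: "bounded (range f) \<longleftrightarrow> (\<exists>B. \<forall>x. norm (f x) \<le> B)"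
  by (auto simp: bounded_iff)

lemma CuI:
  assumes "\<And>x. norm (f x) \<le> B"
    and "\<And>e. e > 0 \<Longrightarrow> \<exists>U. open U \<and> 0 \<in> U \<and> (\<forall>x y. x - y \<in> U \<longrightarrow> dist (f x) (f y) < e)"
  shows "f \<in> Cu"
  using assms by (auto simp: Cu_def bounded_range_iff)

lemma Cu_uniform:
  assumes "f \<in> Cu" "e > 0"
  obtains U where "open U" "0 \<in> U" "\<And>x y. x - y \<in> U \<Longrightarrow> dist (f x) (f y) < e"
  using assms unfolding Cu_def by blast

lemma Cu_bounded: "f \<in> Cu \<Longrightarrow> bounded (range f)"
  by (simp add: Cu_def)

lemma Cu_subset_bounded_cont: "Cu \<subseteq> bounded_cont"
proof
  fix f :: "'a \<Rightarrow> complex" assume f: "f \<in> Cu"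
  have "(f \<longlongrightarrow> f x) (at x)" for x
  proof (rule tendstoI)
    fix e :: real assume "e > 0"
    then obtain U where U: "open U" "0 \<in> U" "\<And>x y. x - y \<in> U \<Longrightarrow> dist (f x) (f y) < e"
      using Cu_uniform[OF f] by blast
    have "open ((\<lambda>y. y - x) -` U)"
      using U(1) by (rule open_vimage) (intro continuous_intros)
    then show "\<forall>\<^sub>F y in at x. dist (f y) (f x) < e"
      unfolding eventually_at_topological using U by (intro exI[of _ "(\<lambda>y. y - x) -` U"]) auto
  qed
  then show "f \<in> bounded_cont"
    using Cu_bounded[OF f] by (simp add: bounded_cont_def continuous_on)
qed

lemma Cu_continuous: "f \<in> Cu \<Longrightarrow> continuous_on UNIV f"
  using Cu_subset_bounded_cont by (auto simp: bounded_cont_def)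

lemma Cu_const: "(\<lambda>_. a) \<in> Cu"
  by (rule CuI[of _ "norm a"]) auto

lemma Cu_add:
  assumes f: "f \<in> Cu" and g: "g \<in> Cu"
  shows "(\<lambda>x. f x + g x) \<in> Cu"
proof (rule CuI)
  show "norm (f x + g x) \<le> sup_norm f + sup_norm g" for x
    using norm_le_sup_norm[OF Cu_bounded[OF f], of x] norm_le_sup_norm[OF Cu_bounded[OF g], of x]
    by norm
  fix e :: real assume "e > 0"
  then have "e/2 > 0" by simp
  obtain U where U: "open U" "0 \<in> U" "\<And>x y. x - y \<in> U \<Longrightarrow> dist (f x) (f y) < e/2"
    using Cu_uniform[OF f \<open>e/2 > 0\<close>] by blast
  obtain V where V: "open V" "0 \<in> V" "\<And>x y. x - y \<in> V \<Longrightarrow> dist (g x) (g y) < e/2"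
    using Cu_uniform[OF g \<open>e/2 > 0\<close>] by blast
  have "dist (f x + g x) (f y + g y) < e" if "x - y \<in> U \<inter> V" for x y
    using U(3)[of x y] V(3)[of x y] that dist_triangle_add[of "f x" "g x" "f y" "g y"] by auto
  then show "\<exists>U. open U \<and> 0 \<in> U \<and> (\<forall>x y. x - y \<in> U \<longrightarrow> dist (f x + g x) (f y + g y) < e)"
    using U V by (intro exI[of _ "U \<inter> V"]) auto
qed

lemma Cu_mult:
  assumes f: "f \<in> Cu" and g: "g \<in> Cu"
  shows "(\<lambda>x. f x * g x) \<in> Cu"
proof (rule CuI)
  let ?F = "sup_norm f" and ?G = "sup_norm g"
  note F = norm_le_sup_norm[OF Cu_bounded[OF f]] and G = norm_le_sup_norm[OF Cu_bounded[OF g]]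
  have F0: "?F \<ge> 0" and G0: "?G \<ge> 0"
    using f g by (auto intro!: sup_norm_nonneg Cu_bounded)
  show "norm (f x * g x) \<le> ?F * ?G" for x
    unfolding norm_mult by (intro mult_mono F G F0) auto
  fix e :: real assume e: "e > 0"
  \<comment> \<open>The error of the product is at most (F + G) d; the summand 1 keeps the
    denominator positive and makes the final inequality strict.\<close>
  define d where "d = e / (?F + ?G + 1)"
  have d: "d > 0" using e F0 G0 by (simp add: d_def)
  obtain U where U: "open U" "0 \<in> U" "\<And>x y. x - y \<in> U \<Longrightarrow> dist (f x) (f y) < d"
    using Cu_uniform[OF f d] by blast
  obtain V where V: "open V" "0 \<in> V" "\<And>x y. x - y \<in> V \<Longrightarrow> dist (g x) (g y) < d"
    using Cu_uniform[OF g d] by blast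
  have "dist (f x * g x) (f y * g y) < e" if "x - y \<in> U \<inter> V" for x y
  proof -
    have "f x * g x - f y * g y = f x * (g x - g y) + (f x - f y) * g y"
      by (simp add: algebra_simps)
    then have "dist (f x * g x) (f y * g y) \<le> norm (f x) * dist (g x) (g y) + dist (f x) (f y) * norm (g y)"
      by (metis dist_norm norm_mult norm_triangle_ineq)
    also have "\<dots> \<le> ?F * d + d * ?G"
      using U(3)[of x y] V(3)[of x y] that d by (intro add_mono mult_mono F G F0) auto
    also have "\<dots> < (?F + ?G + 1) * d"
      using d by (simp add: algebra_simps)
    also have "\<dots> = e"
      using F0 G0 by (simp add: d_def)
    finally show ?thesis .
  qed
  then show "\<exists>U. open U \<and> 0 \<in> U \<and> (\<forall>x y. x - y \<in> U \<longrightarrow> dist (f x * g x) (f y * g y) < e)"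
    using U V by (intro exI[of _ "U \<inter> V"]) auto
qed

lemma Cu_scale: "f \<in> Cu \<Longrightarrow> (\<lambda>x. a * f x) \<in> Cu"
  by (rule Cu_mult[OF Cu_const])

lemma Cu_shift:
  assumes "f \<in> Cu"
  shows "(\<lambda>x. f (x + t)) \<in> Cu"
proof (rule CuI)
  show "norm (f (x + t)) \<le> sup_norm f" for x
    using assms by (intro norm_le_sup_norm Cu_bounded)
  fix e :: real assume "e > 0"
  then obtain U where U: "open U" "0 \<in> U" "\<And>x y. x - y \<in> U \<Longrightarrow> dist (f x) (f y) < e"
    using Cu_uniform[OF assms] by blast
  have "dist (f (x + t)) (f (y + t)) < e" if "x - y \<in> U" for x y
    using that by (intro U(3)) simp
  then show "\<exists>U. open U \<and> 0 \<in> U \<and> (\<forall>x y. x - y \<in> U \<longrightarrow> dist (f (x + t)) (f (y + t)) < e)"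
    using U by blast
qed

lemma Cu_translate: "f \<in> Cu \<Longrightarrow> translate_fun t f \<in> Cu"
  using Cu_shift[of f "- t"] by (simp add: translate_fun_def)

section \<open>Unitary characters\<close>

lemma character_add: "\<xi> \<in> dual_group \<Longrightarrow> \<xi> (x + y) = \<xi> x * \<xi> y"
  by (simp add: dual_group_def)

lemma norm_character: "\<xi> \<in> dual_group \<Longrightarrow> norm (\<xi> x) = 1"
  by (simp add: dual_group_def)

lemma character_zero: "\<xi> \<in> dual_group \<Longrightarrow> \<xi> 0 = 1"
  by (metis add_0 character_add mult_cancel_right1 norm_character norm_zero zero_neq_one)

lemma character_diff:
  assumes "\<xi> \<in> dual_group"
  shows "\<xi> (x - y) = \<xi> x * cnj (\<xi> y)"
proof -
  have 1: "\<xi> y * cnj (\<xi> y) = 1"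
    using norm_character[OF assms, of y] by (metis complex_norm_square of_real_1 one_power2)
  have "\<xi> x = \<xi> (x - y) * \<xi> y"
    using character_add[OF assms, of "x - y" y] by simp
  then have "\<xi> x * cnj (\<xi> y) = \<xi> (x - y) * (\<xi> y * cnj (\<xi> y))"
    by (simp add: mult.assoc)
  then show ?thesis by (simp add: 1)
qed

lemma cnj_character:
  assumes "\<xi> \<in> dual_group" shows "(\<lambda>x. cnj (\<xi> x)) \<in> dual_group"
  using assms by (auto simp: dual_group_def intro!: continuous_intros)

text \<open>Since |\<xi> x - \<xi> y| = |\<xi> (x - y) - 1|, continuity at 0 is already uniform
  continuity.\<close>

lemma character_Cu:
  assumes \<xi>: "\<xi> \<in> dual_group" shows "\<xi> \<in> Cu"
proof (rule CuI)
  show "norm (\<xi> x) \<le> 1" for x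
    using norm_character[OF \<xi>] by simp
  fix e :: real assume "e > 0"
  let ?U = "\<xi> -` ball 1 e"
  have "open ?U"
    using \<xi> by (intro open_vimage) (auto simp: dual_group_def)
  moreover have "dist (\<xi> x) (\<xi> y) < e" if "x - y \<in> ?U" for x y
  proof -
    have "\<xi> x - \<xi> y = (\<xi> (x - y) - 1) * \<xi> y"
      using character_add[OF \<xi>, of "x - y" y] by (simp add: algebra_simps)
    then have "dist (\<xi> x) (\<xi> y) = dist (\<xi> (x - y)) 1"
      using norm_character[OF \<xi>, of y] by (simp add: dist_norm norm_mult)
    with that show ?thesis by (simp add: dist_commute)
  qed
  ultimately show "\<exists>U. open U \<and> 0 \<in> U \<and> (\<forall>x y. x - y \<in> U \<longrightarrow> dist (\<xi> x) (\<xi> y) < e)"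
    using \<open>e > 0\<close> character_zero[OF \<xi>] by (intro exI[of _ ?U]) auto
qed

section \<open>The weak topology\<close>

lemma Cu_dual_add: "\<phi> \<in> Cu_dual \<Longrightarrow> f \<in> Cu \<Longrightarrow> g \<in> Cu \<Longrightarrow> \<phi> (\<lambda>x. f x + g x) = \<phi> f + \<phi> g"
  by (simp add: Cu_dual_def)

lemma Cu_dual_scale: "\<phi> \<in> Cu_dual \<Longrightarrow> f \<in> Cu \<Longrightarrow> \<phi> (\<lambda>x. a * f x) = a * \<phi> f"
  by (simp add: Cu_dual_def)

lemma Cu_dual_diff:
  assumes "\<phi> \<in> Cu_dual" "f \<in> Cu" "g \<in> Cu"
  shows "\<phi> (\<lambda>x. f x - g x) = \<phi> f - \<phi> g"
  using Cu_dual_add[OF assms(1,2) Cu_scale[OF assms(3), of "-1"]] Cu_dual_scale[OF assms(1,3), of "-1"]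
  by simp

text \<open>The constant is enlarged to |B| + 1 so that later estimates can divide by it, and the
  sup norm is replaced by any pointwise bound \<open>M\<close>.\<close>

lemma Cu_dual_bound:
  assumes "\<phi> \<in> Cu_dual"
  obtains B where "B > 0" "\<And>f M. f \<in> Cu \<Longrightarrow> (\<And>x. norm (f x) \<le> M) \<Longrightarrow> norm (\<phi> f) \<le> B * M"
proof -
  obtain B where B: "\<And>f. f \<in> Cu \<Longrightarrow> norm (\<phi> f) \<le> B * sup_norm f"
    using assms unfolding Cu_dual_def by blast
  have "norm (\<phi> f) \<le> (\<bar>B\<bar> + 1) * M" if f: "f \<in> Cu" and M: "\<And>x. norm (f x) \<le> M" for f M
  proof -
    have "norm (\<phi> f) \<le> B * sup_norm f"
      using B f by blast
    also have "\<dots> \<le> (\<bar>B\<bar> + 1) * M"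
      using sup_norm_nonneg[OF Cu_bounded[OF f]] sup_norm_least[OF M]
      by (intro mult_mono) auto
    finally show ?thesis .
  qed
  then show thesis
    by (intro that[of "\<bar>B\<bar> + 1"]) auto
qed

lemma Cu_dualI:
  assumes "\<And>f g. f \<in> Cu \<Longrightarrow> g \<in> Cu \<Longrightarrow> \<phi> (\<lambda>x. f x + g x) = \<phi> f + \<phi> g"
    and "\<And>a f. f \<in> Cu \<Longrightarrow> \<phi> (\<lambda>x. a * f x) = a * \<phi> f"
    and "\<And>f. f \<in> Cu \<Longrightarrow> norm (\<phi> f) \<le> B * sup_norm f"
  shows "\<phi> \<in> Cu_dual"
  using assms unfolding Cu_dual_def by blast

lemma Cu_dual_eval: "(\<lambda>f. f x) \<in> Cu_dual"
  by (rule Cu_dualI[of _ 1]) (auto intro: norm_le_sup_norm Cu_bounded)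

text \<open>This makes multiplication by a fixed function weakly continuous. It is applied to
  characters, so that the twist of a measure can be moved into the functional.\<close>

lemma Cu_dual_mult:
  assumes \<phi>: "\<phi> \<in> Cu_dual" and h: "h \<in> Cu"
  shows "(\<lambda>f. \<phi> (\<lambda>x. h x * f x)) \<in> Cu_dual"
proof -
  obtain B where B: "B > 0" "\<And>f M. f \<in> Cu \<Longrightarrow> (\<And>x. norm (f x) \<le> M) \<Longrightarrow> norm (\<phi> f) \<le> B * M"
    using Cu_dual_bound[OF \<phi>] by blast
  show ?thesis
  proof (rule Cu_dualI)
    show "\<phi> (\<lambda>x. h x * (f x + g x)) = \<phi> (\<lambda>x. h x * f x) + \<phi> (\<lambda>x. h x * g x)"
      if "f \<in> Cu" "g \<in> Cu" for f g
      using Cu_dual_add[OF \<phi> Cu_mult[OF h that(1)] Cu_mult[OF h that(2)]] by (simp add: distrib_left)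
    show "\<phi> (\<lambda>x. h x * (a * f x)) = a * \<phi> (\<lambda>x. h x * f x)" if "f \<in> Cu" for a f
      using Cu_dual_scale[OF \<phi> Cu_mult[OF h that], of a] by (simp add: mult.left_commute)
    show "norm (\<phi> (\<lambda>x. h x * f x)) \<le> (B * sup_norm h) * sup_norm f" if "f \<in> Cu" for f
    proof -
      have "norm (h x * f x) \<le> sup_norm h * sup_norm f" for x
        unfolding norm_mult using h that
        by (intro mult_mono norm_le_sup_norm sup_norm_nonneg Cu_bounded) auto
      from B(2)[OF Cu_mult[OF h that] this] show ?thesis by (simp add: mult.assoc)
    qed
  qed
qed

lemma Cu_dual_translate:
  assumes \<phi>: "\<phi> \<in> Cu_dual"
  shows "(\<lambda>f. \<phi> (translate_fun t f)) \<in> Cu_dual"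
proof -
  obtain B where B: "B > 0" "\<And>f M. f \<in> Cu \<Longrightarrow> (\<And>x. norm (f x) \<le> M) \<Longrightarrow> norm (\<phi> f) \<le> B * M"
    using Cu_dual_bound[OF \<phi>] by blast
  show ?thesis
  proof (rule Cu_dualI)
    show "\<phi> (translate_fun t (\<lambda>x. f x + g x)) = \<phi> (translate_fun t f) + \<phi> (translate_fun t g)"
      if "f \<in> Cu" "g \<in> Cu" for f g
      using Cu_dual_add[OF \<phi> Cu_translate[OF that(1)] Cu_translate[OF that(2)], of t]
      by (simp add: translate_fun_def)
    show "\<phi> (translate_fun t (\<lambda>x. a * f x)) = a * \<phi> (translate_fun t f)" if "f \<in> Cu" for a f
      using Cu_dual_scale[OF \<phi> Cu_translate[OF that], of a t] by (simp add: translate_fun_def)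
    show "norm (\<phi> (translate_fun t f)) \<le> B * sup_norm f" if "f \<in> Cu" for f
      using that
      by (intro B(2) Cu_translate) (auto simp: translate_fun_def intro: norm_le_sup_norm Cu_bounded)
  qed
qed

lemma openin_Cu_weak:
  "\<phi> \<in> Cu_dual \<Longrightarrow> open U \<Longrightarrow> openin Cu_weak {f \<in> Cu. \<phi> f \<in> U}"
  unfolding Cu_weak_def by (rule topology_generated_by_Basis) auto

lemma topspace_Cu_weak: "topspace Cu_weak = Cu"
proof -
  have "Cu \<in> {{f \<in> Cu. \<phi> f \<in> U} |\<phi> U. \<phi> \<in> Cu_dual \<and> open U}"
    using Cu_dual_eval[of undefined] by (auto intro!: exI[of _ "\<lambda>f. f undefined"] exI[of _ UNIV])
  then show ?thesis
    unfolding Cu_weak_def topology_generated_by_topspace by blast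
qed

lemma continuous_map_Cu_weak:
  fixes F :: "'b \<Rightarrow> 'a::topological_ab_group_add \<Rightarrow> complex"
  assumes "\<And>x. x \<in> topspace X \<Longrightarrow> F x \<in> Cu"
    and "\<And>\<phi>. \<phi> \<in> Cu_dual \<Longrightarrow> continuous_map X euclidean (\<lambda>x. \<phi> (F x))"
  shows "continuous_map X Cu_weak F"
  unfolding Cu_weak_def continuous_on_generated_topo_iff
proof (intro conjI allI impI)
  fix V :: "('a \<Rightarrow> complex) set" assume "V \<in> {{f \<in> Cu. \<phi> f \<in> U} |\<phi> U. \<phi> \<in> Cu_dual \<and> open U}"
  then obtain \<phi> U where V: "V = {f \<in> Cu. \<phi> f \<in> U}" "\<phi> \<in> Cu_dual" "open U"
    by blast
  have "F -` V \<inter> topspace X = {x \<in> topspace X. \<phi> (F x) \<in> U}"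
    using assms(1) V by auto
  then show "openin X (F -` V \<inter> topspace X)"
    using openin_continuous_map_preimage[OF assms(2)[OF V(2)], of U] V(3) by simp
next
  show "F ` topspace X \<subseteq> \<Union> {{f \<in> Cu. \<phi> f \<in> U} |\<phi> U. \<phi> \<in> Cu_dual \<and> open U}"
    using assms(1) topspace_Cu_weak unfolding Cu_weak_def topology_generated_by_topspace by blast
qed

lemma continuous_map_Cu_dual:
  assumes "\<phi> \<in> Cu_dual" shows "continuous_map Cu_weak euclidean \<phi>"
  unfolding continuous_map_def using openin_Cu_weak[OF assms] by (auto simp: topspace_Cu_weak)

lemma compactin_Cu_weak_subset: "compactin Cu_weak K \<Longrightarrow> K \<subseteq> Cu"
  using compactin_subset_topspace topspace_Cu_weak by blast

lemma continuous_map_translate: "continuous_map Cu_weak Cu_weak (translate_fun t)"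
  by (intro continuous_map_Cu_weak continuous_map_Cu_dual Cu_dual_translate)
    (simp_all add: topspace_Cu_weak Cu_translate)

section \<open>Weak closures of translation orbits\<close>

abbreviation orbit_closure :: "('a::topological_ab_group_add \<Rightarrow> complex) \<Rightarrow> ('a \<Rightarrow> complex) set" where
  "orbit_closure f \<equiv> Cu_weak closure_of (range (\<lambda>t. translate_fun t f))"

lemma translate_fun_translate_fun: "translate_fun s (translate_fun t f) = translate_fun (t + s) f"
  by (simp add: translate_fun_def algebra_simps)

text \<open>Translation is weakly continuous and maps the orbit into itself. Hence for a limit point
  too, all translates lie in one weakly compact set.\<close>

lemma translate_orbit_closure:
  assumes "g \<in> orbit_closure f" shows "translate_fun t g \<in> orbit_closure f"
proof -
  let ?O = "range (\<lambda>s. translate_fun s f)"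
  have 1: "translate_fun t g \<in> translate_fun t ` orbit_closure f"
    using assms by (rule imageI)
  have 2: "translate_fun t ` orbit_closure f \<subseteq> Cu_weak closure_of (translate_fun t ` ?O)"
    by (rule continuous_map_image_closure_subset[OF continuous_map_translate])
  have 3: "translate_fun t ` ?O \<subseteq> ?O"
    by (auto simp: translate_fun_translate_fun)
  show ?thesis
    by (rule subsetD[OF closure_of_mono[OF 3] subsetD[OF 2 1]])
qed

lemma orbit_closure_contains:
  assumes "f \<in> Cu" shows "translate_fun t f \<in> orbit_closure f"
proof -
  have "range (\<lambda>t. translate_fun t f) \<subseteq> topspace Cu_weak"
    using assms by (auto simp: topspace_Cu_weak Cu_translate)
  then show ?thesis
    using closure_of_subset by fast
qed

text \<open>The preimage of a closed set under a functional is weakly closed. This is the device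
  that carries bounds and values of invariant functionals from the orbit to its closure.\<close>

lemma orbit_closure_dual:
  assumes g: "g \<in> orbit_closure f" and \<phi>: "\<phi> \<in> Cu_dual" and C: "closed C"
    and "\<And>t. \<phi> (translate_fun t f) \<in> C"
  shows "\<phi> g \<in> C"
proof (rule ccontr)
  assume "\<phi> g \<notin> C"
  then have g': "g \<in> {h \<in> Cu. \<phi> h \<in> - C}"
    using g by (simp add: in_closure_of topspace_Cu_weak)
  have "openin Cu_weak {h \<in> Cu. \<phi> h \<in> - C}"
    by (rule openin_Cu_weak[OF \<phi> open_Compl[OF C]])
  with g g' obtain h where "h \<in> range (\<lambda>t. translate_fun t f)" "h \<in> {h \<in> Cu. \<phi> h \<in> - C}"
    unfolding in_closure_of by meson
  then show False
    using assms(4) by auto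
qed

lemma orbit_closure_bound:
  assumes "g \<in> orbit_closure f" and "\<And>x. norm (f x) \<le> M"
  shows "norm (g x) \<le> M"
proof -
  have "(\<lambda>h. h x) g \<in> cball 0 M"
    by (rule orbit_closure_dual[OF assms(1) Cu_dual_eval]) (auto simp: translate_fun_def assms(2))
  then show ?thesis by simp
qed

text \<open>Uniform continuity of \<open>f\<close> makes the orbit map continuous for the sup norm,
  hence weakly. The sign is chosen so that the point \<open>s\<close> gives x |-> f (x + s).\<close>

lemma continuous_map_orbit:
  assumes f: "f \<in> Cu"
  shows "continuous_map euclidean Cu_weak (\<lambda>s. translate_fun (- s) f)"
proof (rule continuous_map_Cu_weak)
  show "translate_fun (- s) f \<in> Cu" for s
    by (rule Cu_translate[OF f])
  fix \<phi> :: "('a \<Rightarrow> complex) \<Rightarrow> complex" assume \<phi>: "\<phi> \<in> Cu_dual"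
  obtain B where B: "B > 0" "\<And>f M. f \<in> Cu \<Longrightarrow> (\<And>x. norm (f x) \<le> M) \<Longrightarrow> norm (\<phi> f) \<le> B * M"
    using Cu_dual_bound[OF \<phi>] by blast
  \<comment> \<open>The estimate depends on s - r only, so it gives uniform continuity at once, and
    continuity is a consequence.\<close>
  have "(\<lambda>s. \<phi> (translate_fun (- s) f)) \<in> Cu"
  proof (rule CuI)
    show "norm (\<phi> (translate_fun (- s) f)) \<le> B * sup_norm f" for s
      using f by (intro B(2) Cu_translate) (auto simp: translate_fun_def intro: norm_le_sup_norm Cu_bounded)
    fix e :: real assume e: "e > 0"
    then have "e / (2 * B) > 0" using B by simp
    then obtain U where U: "open U" "0 \<in> U" "\<And>x y. x - y \<in> U \<Longrightarrow> dist (f x) (f y) < e / (2 * B)"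
      using Cu_uniform[OF f] by blast
    have "dist (\<phi> (translate_fun (- s) f)) (\<phi> (translate_fun (- r) f)) < e" if "s - r \<in> U" for s r
    proof -
      have "norm (f (x + s) - f (x + r)) \<le> e / (2 * B)" for x
        using U(3)[of "x + s" "x + r"] that by (simp add: dist_norm)
      moreover have "(\<lambda>x. f (x + s) - f (x + r)) \<in> Cu"
        using Cu_add[OF Cu_shift[OF f, of s] Cu_scale[OF Cu_shift[OF f, of r], of "-1"]] by simp
      ultimately have "norm (\<phi> (\<lambda>x. f (x + s) - f (x + r))) \<le> B * (e / (2 * B))"
        by (intro B(2))
      also have "\<dots> < e" using B e by simp
      finally show ?thesis
        using Cu_dual_diff[OF \<phi> Cu_shift[OF f, of s] Cu_shift[OF f, of r]]
        by (simp add: translate_fun_def dist_norm)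
    qed
    then show "\<exists>U. open U \<and> 0 \<in> U \<and> (\<forall>s r. s - r \<in> U \<longrightarrow>
        dist (\<phi> (translate_fun (- s) f)) (\<phi> (translate_fun (- r) f)) < e)"
      using U by blast
  qed
  then show "continuous_map euclidean euclidean (\<lambda>s. \<phi> (translate_fun (- s) f))"
    by (simp add: Cu_continuous)
qed

text \<open>The weak topology is finer than the topology of pointwise convergence, which is Hausdorff;
  hence the two agree on weakly compact sets.\<close>

abbreviation pointwise :: "('a \<Rightarrow> complex) topology" where
  "pointwise \<equiv> product_topology (\<lambda>_. euclidean) UNIV"

lemma closedin_pointwise:
  assumes "compactin Cu_weak K" shows "closedin pointwise K"
proof -
  have "continuous_map Cu_weak pointwise (\<lambda>f. f)"
    unfolding continuous_map_componentwise_UNIV using continuous_map_Cu_dual[OF Cu_dual_eval] by blast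
  then have "compactin pointwise ((\<lambda>f. f) ` K)"
    by (rule image_compactin[OF assms])
  then show ?thesis
    by (intro compactin_imp_closedin) (auto simp: Hausdorff_space_product_topology)
qed

lemma continuous_map_Cu_weak_pointwise:
  fixes F :: "'b \<Rightarrow> 'a::topological_ab_group_add \<Rightarrow> complex"
  assumes K: "compactin Cu_weak K" and FK: "\<And>x. x \<in> topspace X \<Longrightarrow> F x \<in> K"
    and F: "continuous_map X pointwise F"
  shows "continuous_map X Cu_weak F"
  unfolding continuous_map_closedin
proof (intro conjI allI impI funcsetI)
  show "F x \<in> topspace Cu_weak" if "x \<in> topspace X" for x
    using FK[OF that] compactin_subset_topspace[OF K] by blast
  fix C :: "('a \<Rightarrow> complex) set" assume C: "closedin Cu_weak C"
  \<comment> \<open>A weakly closed \<open>C\<close> need not be closed pointwise, but its part in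
    \<open>K\<close> is weakly compact and therefore is.\<close>
  have "closedin X {x \<in> topspace X. F x \<in> C \<inter> K}"
    by (rule closedin_continuous_map_preimage[OF F closedin_pointwise[OF closed_Int_compactin[OF C K]]])
  moreover have "{x \<in> topspace X. F x \<in> C \<inter> K} = {x \<in> topspace X. F x \<in> C}"
    using FK by blast
  ultimately show "closedin X {x \<in> topspace X. F x \<in> C}" by simp
qed

lemma continuous_map_complex_mult:
  fixes f g :: "'b \<Rightarrow> complex"
  assumes "continuous_map X euclidean f" "continuous_map X euclidean g"
  shows "continuous_map X euclidean (\<lambda>x. f x * g x)"
proof -
  have "continuous_map X euclidean (\<lambda>x. (f x, g x))"
    using continuous_map_pairedI[OF assms] by (simp add: euclidean_product_topology)
  moreover have "continuous_map euclidean euclidean (\<lambda>z::complex \<times> complex. fst z * snd z)"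
    by (simp add: continuous_intros)
  ultimately have "continuous_map X euclidean ((\<lambda>z. fst z * snd z) \<circ> (\<lambda>x. (f x, g x)))"
    by (rule continuous_map_compose)
  then show ?thesis
    by (simp add: o_def)
qed

text \<open>Translating by t turns the product of \<xi> and g into \<open>cnj (\<xi> t)\<close>
  times \<xi> times the translate of g. So \<open>L\<close> can be the image of (unit circle) x
  \<open>K\<close> under (a, g) |-> a \<xi> g, which is jointly continuous because each functional
  applied to it is a product of two continuous functions.\<close>

lemma compactin_times_character:
  fixes \<xi> :: "'a::topological_ab_group_add \<Rightarrow> complex"
  assumes \<xi>: "\<xi> \<in> dual_group" and K: "compactin Cu_weak K"
    and g: "\<And>t. translate_fun t g \<in> K"
  obtains L where "compactin Cu_weak L" "\<And>t. translate_fun t (\<lambda>x. \<xi> x * g x) \<in> L"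
proof -
  let ?F = "\<lambda>p. \<lambda>x. fst p * (\<xi> x * snd p x)"
  let ?X = "prod_topology (euclidean :: complex topology) Cu_weak"
  have "continuous_map ?X Cu_weak ?F"
  proof (rule continuous_map_Cu_weak)
    fix p :: "complex \<times> ('a \<Rightarrow> complex)" assume "p \<in> topspace ?X"
    then have "snd p \<in> Cu"
      by (auto simp: topspace_Cu_weak)
    then show "?F p \<in> Cu"
      by (intro Cu_scale Cu_mult character_Cu[OF \<xi>])
  next
    fix \<phi> :: "('a \<Rightarrow> complex) \<Rightarrow> complex" assume \<phi>: "\<phi> \<in> Cu_dual"
    have "continuous_map ?X euclidean ((\<lambda>g. \<phi> (\<lambda>x. \<xi> x * g x)) \<circ> snd)"
      by (rule continuous_map_compose[OF continuous_map_snd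
            continuous_map_Cu_dual[OF Cu_dual_mult[OF \<phi> character_Cu[OF \<xi>]]]])
    then have "continuous_map ?X euclidean (\<lambda>p. fst p * \<phi> (\<lambda>x. \<xi> x * snd p x))"
      by (intro continuous_map_complex_mult continuous_map_fst) (simp add: o_def)
    moreover have "fst p * \<phi> (\<lambda>x. \<xi> x * snd p x) = \<phi> (?F p)" if "p \<in> topspace ?X" for p
    proof -
      have "snd p \<in> Cu"
        using that by (auto simp: topspace_Cu_weak)
      then show ?thesis
        using Cu_dual_scale[OF \<phi> Cu_mult[OF character_Cu[OF \<xi>]]] by simp
    qed
    ultimately show "continuous_map ?X euclidean (\<lambda>p. \<phi> (?F p))"
      by (rule continuous_map_eq)
  qed
  moreover have "compactin ?X (sphere 0 1 \<times> K)"
    using K by (simp add: compactin_Times)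
  ultimately have "compactin Cu_weak (?F ` (sphere 0 1 \<times> K))"
    by (rule image_compactin[rotated])
  moreover have "translate_fun t (\<lambda>x. \<xi> x * g x) \<in> ?F ` (sphere 0 1 \<times> K)" for t
    using g[of t] norm_character[OF \<xi>, of t]
    by (intro image_eqI[of _ _ "(cnj (\<xi> t), translate_fun t g)"])
      (auto simp: translate_fun_def character_diff[OF \<xi>])
  ultimately show thesis using that by blast
qed

section \<open>Bounded convergence for positive functionals\<close>

text \<open>A one-sided Dini theorem at a single level: if no \<open>n\<close> worked, the
  decreasing closed sets where \<open>u n\<close> is at least \<open>e\<close> would have a common
  point.\<close>

lemma Dini_nonneg:
  fixes u :: "nat \<Rightarrow> 'x \<Rightarrow> real"
  assumes X: "compact_space X" and cont: "\<And>n. continuous_map X euclideanreal (u n)"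
    and dec: "\<And>n x. x \<in> topspace X \<Longrightarrow> u (Suc n) x \<le> u n x"
    and small: "\<And>x. x \<in> topspace X \<Longrightarrow> \<exists>n. u n x < e"
  obtains n where "\<And>x. x \<in> topspace X \<Longrightarrow> u n x < e"
proof -
  let ?C = "\<lambda>n. {x \<in> topspace X. u n x \<in> {e..}}"
  have "\<exists>n. ?C n = {}"
  proof (rule ccontr)
    assume ne: "\<nexists>n. ?C n = {}"
    have "\<Inter> (range ?C) \<noteq> {}"
    proof (rule compact_space_imp_nest[OF X])
      show "closedin X (?C n)" for n
        by (rule closedin_continuous_map_preimage[OF cont]) simp
      show "antimono_on UNIV ?C"
      proof (rule antimonoI)
        fix m n :: nat assume "m \<le> n"
        then have "u n x \<le> u m x" if "x \<in> topspace X" for x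
          using lift_Suc_antimono_le[of "\<lambda>n. u n x" m n] dec[OF that] by blast
        then show "?C n \<subseteq> ?C m" by force
      qed
      show "?C n \<noteq> {}" for n
        using ne by blast
    qed
    then obtain x where x: "x \<in> ?C n" for n
      by blast
    then have "x \<in> topspace X" by simp
    then obtain n where "u n x < e"
      using small by blast
    with x[of n] show False by simp
  qed
  then obtain n where "?C n = {}" ..
  then have "u n x < e" if "x \<in> topspace X" for x
    using that by (auto simp: not_le[symmetric])
  then show thesis by (rule that)
qed

text \<open>The integral-free proof of bounded convergence: replace \<open>h n\<close> by finite maxima almost attaining
  the tail suprema under \<open>p\<close>; running minima of these decrease to \<open>0\<close> and Dini's theorem applies.\<close>

lemma bounded_convergence_functional:
  fixes p :: "('x \<Rightarrow> real) \<Rightarrow> real" and h :: "nat \<Rightarrow> 'x \<Rightarrow> real"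
  assumes X: "compact_space X"
    and add: "\<And>u v. continuous_map X euclideanreal u \<Longrightarrow> continuous_map X euclideanreal v
        \<Longrightarrow> p (\<lambda>x. u x + v x) = p u + p v"
    and mono: "\<And>u v. continuous_map X euclideanreal u \<Longrightarrow> continuous_map X euclideanreal v
        \<Longrightarrow> (\<And>x. x \<in> topspace X \<Longrightarrow> u x \<le> v x) \<Longrightarrow> p u \<le> p v"
    and const: "\<And>c. p (\<lambda>_. c) \<le> c"
    and cont: "\<And>n. continuous_map X euclideanreal (h n)"
    and bound: "\<And>n x. x \<in> topspace X \<Longrightarrow> h n x \<le> B"
    and lim: "\<And>x. x \<in> topspace X \<Longrightarrow> (\<lambda>n. h n x) \<longlonglongrightarrow> 0"
    and e: "e > 0"
  shows "\<exists>n. p (h n) < e"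
proof (rule ccontr)
  assume "\<nexists>n. p (h n) < e"
  then have low: "e \<le> p (h n)" for n
    by (simp add: not_less)
  \<comment> \<open>The maximum of h N, ..., h (N + k): a continuous stand-in for the tail supremum
    of the sequence, which may fail to be continuous.\<close>
  define g where "g N k = rec_nat (h N) (\<lambda>k f x. max (f x) (h (N + Suc k) x)) k" for N k
  have g0: "g N 0 = h N" and gS: "g N (Suc k) = (\<lambda>x. max (g N k x) (h (N + Suc k) x))" for N k
    by (simp_all add: g_def)
  have g_cont: "continuous_map X euclideanreal (g N k)" for N k
    by (induction k) (auto simp: g0 gS intro!: continuous_map_real_max cont)
  have g_mono: "g N k x \<le> g N m x" if "k \<le> m" for N k m x
    using lift_Suc_mono_le[of "\<lambda>k. g N k x", OF _ that] by (simp add: gS)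
  have g_Suc: "g (Suc N) k x \<le> g N (Suc k) x" for N k x
    by (induction k) (auto simp: g0 gS)
  have g_le: "g N k x \<le> c" if "\<And>n. n \<ge> N \<Longrightarrow> h n x \<le> c" for N k x c
    by (induction k) (auto simp: g0 gS that)
  have pg_le: "p (g N k) \<le> B" for N k
  proof -
    have "p (g N k) \<le> p (\<lambda>_. B)"
      by (rule mono[OF g_cont]) (auto intro: g_le bound)
    with const[of B] show ?thesis by linarith
  qed
  \<comment> \<open>Plays the part of the integral of the tail supremum from \<open>N\<close>
    on.\<close>
  define \<alpha> where "\<alpha> N = (SUP k. p (g N k))" for N
  have \<alpha>: "p (g N k) \<le> \<alpha> N" for N k
    unfolding \<alpha>_def using pg_le by (intro cSUP_upper) (auto simp: bdd_above_def)
  \<comment> \<open>The losses e / 2^(N + 2) add up to e/2 over all N, so half of the lower bound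
    \<open>e\<close> survives all the minima taken below.\<close>
  have "\<exists>k. \<alpha> N - e / 2 ^ (N + 2) < p (g N k)" for N
  proof -
    have "\<alpha> N - e / 2 ^ (N + 2) < Sup (range (\<lambda>k. p (g N k)))"
      using e by (simp add: \<alpha>_def)
    then show ?thesis
      by (auto dest: less_cSupD[rotated])
  qed
  then obtain k where k: "\<And>N. \<alpha> N - e / 2 ^ (N + 2) < p (g N (k N))"
    by metis
  define v where "v N = g N (k N)" for N
  \<comment> \<open>The minimum of v 0, ..., v N, which makes the sequence decreasing as Dini's
    theorem requires.\<close>
  define u where "u N = rec_nat (v 0) (\<lambda>N f x. min (f x) (v (Suc N) x)) N" for N
  have u0: "u 0 = v 0" and uS: "u (Suc N) = (\<lambda>x. min (u N x) (v (Suc N) x))" for N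
    by (simp_all add: u_def)
  have v_cont: "continuous_map X euclideanreal (v N)" for N
    by (simp add: v_def g_cont)
  have u_cont: "continuous_map X euclideanreal (u N)" for N
    by (induction N) (auto simp: u0 uS intro!: continuous_map_real_min v_cont)
  have u_le_v: "u N x \<le> v N x" for N x
    by (cases N) (auto simp: u0 uS)
  \<comment> \<open>The loss after N steps is at most the partial sum e/2 - e / 2^(N + 1) of the
    series above; keeping the remainder in the claim lets the induction close.\<close>
  have "p (v N) - e / 2 + e / 2 ^ (N + 1) \<le> p (u N)" for N
  proof (induction N)
    case 0
    then show ?case by (simp add: u0)
  next
    case (Suc N)
    \<comment> \<open>Long enough for \<open>g N ?K\<close> to dominate both \<open>v N\<close> and
      \<open>v (Suc N)\<close>; the latter starts one index later, whence the extra
      \<open>Suc\<close>.\<close>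
    let ?K = "max (k N) (Suc (k (Suc N)))"
    let ?m = "\<lambda>x. max (u N x) (v (Suc N) x)"
    have m_cont: "continuous_map X euclideanreal ?m"
      by (intro continuous_map_real_max u_cont v_cont)
    have "?m x \<le> g N ?K x" for x
    proof -
      have "u N x \<le> g N ?K x"
        using u_le_v[of N x] g_mono[of "k N" ?K N x] by (simp add: v_def)
      moreover have "v (Suc N) x \<le> g N ?K x"
        using g_Suc[of N "k (Suc N)" x] g_mono[of "Suc (k (Suc N))" ?K N x] by (simp add: v_def)
      ultimately show ?thesis by simp
    qed
    then have "p ?m \<le> p (g N ?K)"
      by (intro mono m_cont g_cont)
    also have "\<dots> < p (v N) + e / 2 ^ (N + 2)"
      using \<alpha>[of N ?K] k[of N] by (simp add: v_def)
    finally have 1: "p ?m < p (v N) + e / 2 ^ (N + 2)" .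
    \<comment> \<open>A sum of two numbers is their maximum plus their minimum. As the maximum costs
      little more than \<open>p (v N)\<close>, the minimum must keep nearly all of
      \<open>p (v (Suc N))\<close>.\<close>
    have "(\<lambda>x. u N x + v (Suc N) x) = (\<lambda>x. ?m x + u (Suc N) x)"
      by (auto simp: uS)
    then have "p (u N) + p (v (Suc N)) = p ?m + p (u (Suc N))"
      using add[OF u_cont v_cont, of N "Suc N"] add[OF m_cont u_cont, of "Suc N"] by simp
    moreover have "e / 2 ^ (N + 1) = e / 2 ^ (N + 2) + e / 2 ^ (Suc N + 1)"
      by (simp add: field_simps)
    ultimately show ?case
      using 1 Suc.IH by linarith
  qed
  moreover have "e \<le> p (v N)" for N
  proof -
    have "p (g N 0) \<le> p (g N (k N))"
      by (intro mono g_cont g_mono) simp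
    then show ?thesis using low[of N] by (simp add: v_def g0)
  qed
  ultimately have u_low: "e / 2 \<le> p (u N)" for N
  proof -
    have "e / 2 ^ (N + 1) > 0" using e by simp
    with \<open>p (v N) - e / 2 + e / 2 ^ (N + 1) \<le> p (u N)\<close> \<open>e \<le> p (v N)\<close> show ?thesis
      by linarith
  qed
  \<comment> \<open>Any uniform bound below e/2 would contradict \<open>u_low\<close>; e/8 is used
    pointwise so that the bound e/4 is strict.\<close>
  obtain N where N: "\<And>x. x \<in> topspace X \<Longrightarrow> u N x < e / 4"
  proof (rule Dini_nonneg[OF X u_cont])
    show "u (Suc n) x \<le> u n x" for n x
      by (simp add: uS)
    show "\<exists>n. u n x < e / 4" if x: "x \<in> topspace X" for x
    proof -
      have "\<forall>\<^sub>F n in sequentially. h n x < e / 8"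
        using lim[OF x] e by (intro order_tendstoD) auto
      then obtain N where "\<And>n. n \<ge> N \<Longrightarrow> h n x < e / 8"
        by (auto simp: eventually_sequentially)
      then have "v N x \<le> e / 8"
        unfolding v_def by (intro g_le less_imp_le)
      then show ?thesis
        using u_le_v[of N x] e by (intro exI[of _ N]) linarith
    qed
  qed blast
  have "p (u N) \<le> p (\<lambda>_. e / 4)"
    using N by (intro mono u_cont) (auto intro: less_imp_le)
  then show False
    using const[of "e / 4"] u_low[of N] e by linarith
qed

section \<open>Compactly supported functions\<close>

lemma Cc_continuous: "f \<in> Cc \<Longrightarrow> continuous_on UNIV f"
  by (simp add: Cc_def)

lemma Cc_compact_supp: "f \<in> Cc \<Longrightarrow> compact (supp f)"
  by (simp add: Cc_def)

lemma supp_nonzero: "f x \<noteq> 0 \<Longrightarrow> x \<in> supp f"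
  unfolding supp_def using closure_subset[of "{x. f x \<noteq> 0}"] by auto

lemma supp_subset:
  fixes K :: "'a::t2_space set"
  assumes "compact K" "\<And>x. f x \<noteq> 0 \<Longrightarrow> x \<in> K"
  shows "supp f \<subseteq> K"
  unfolding supp_def using assms by (intro closure_minimal compact_imp_closed) auto

lemma CcI:
  fixes K :: "'a::t2_space set"
  assumes f: "continuous_on UNIV f" and K: "compact K" "\<And>x. f x \<noteq> 0 \<Longrightarrow> x \<in> K"
  shows "f \<in> Cc"
proof -
  have "compact (K \<inter> supp f)"
    using K(1) by (rule compact_Int_closed) (simp add: supp_def)
  then show ?thesis
    using f supp_subset[of K f, OF K] by (simp add: Cc_def Int_absorb1)
qed

lemma Cc_add:
  fixes f :: "'a::t2_space \<Rightarrow> complex"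
  assumes "f \<in> Cc" "g \<in> Cc" shows "(\<lambda>x. f x + g x) \<in> Cc"
proof (rule CcI)
  show "continuous_on UNIV (\<lambda>x. f x + g x)"
    using assms by (intro continuous_on_add Cc_continuous)
  show "compact (supp f \<union> supp g)"
    using assms by (intro compact_Un Cc_compact_supp)
  show "x \<in> supp f \<union> supp g" if "f x + g x \<noteq> 0" for x
    using that supp_nonzero[of f x] supp_nonzero[of g x] by (cases "f x = 0") simp_all
qed

lemma Cc_scale:
  fixes f :: "'a::t2_space \<Rightarrow> complex"
  assumes "f \<in> Cc" shows "(\<lambda>x. a * f x) \<in> Cc"
proof (rule CcI)
  show "continuous_on UNIV (\<lambda>x. a * f x)"
    using Cc_continuous[OF assms] by (intro continuous_on_mult continuous_on_const)
  show "x \<in> supp f" if "a * f x \<noteq> 0" for x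
    using that supp_nonzero[of f x] by simp
qed (rule Cc_compact_supp[OF assms])

lemma Cc_zero: "(\<lambda>_::'a::t2_space. 0) \<in> Cc"
  by (rule CcI[of _ "{}"]) auto

lemma Cc_sum:
  fixes f :: "'i \<Rightarrow> 'a::t2_space \<Rightarrow> complex"
  assumes "\<And>i. i \<in> I \<Longrightarrow> f i \<in> Cc"
  shows "(\<lambda>x. \<Sum>i\<in>I. f i x) \<in> Cc"
  using assms by (induction I rule: infinite_finite_induct) (auto simp: Cc_zero Cc_add)

lemma Cc_reflect:
  fixes f :: "'a::{topological_ab_group_add, t2_space} \<Rightarrow> complex"
  assumes "f \<in> Cc" shows "(\<lambda>s. f (x - s)) \<in> Cc"
proof (rule CcI)
  show "continuous_on UNIV (\<lambda>s. f (x - s))"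
    by (rule continuous_on_compose2[OF Cc_continuous[OF assms]]) (intro continuous_intros, simp)
  show "compact ((\<lambda>y. x - y) ` supp f)"
    by (rule compact_continuous_image[OF _ Cc_compact_supp[OF assms]]) (intro continuous_intros)
  show "s \<in> (\<lambda>y. x - y) ` supp f" if "f (x - s) \<noteq> 0" for s
    using supp_nonzero[of f "x - s"] that by (intro image_eqI[of _ _ "x - s"]) simp_all
qed

lemma Cc_shift:
  fixes f :: "'a::topological_ab_group_add \<Rightarrow> complex"
  assumes "f \<in> Cc" shows "(\<lambda>s. f (s + t)) \<in> Cc"
  using Cc_translate[OF assms, of t] by (simp add: add.commute)

text \<open>Heine's theorem for the group uniformity: finitely many neighbourhoods x + V x cover the
  support, and the intersection of the sets V x serves all points at once.\<close>

lemma Cc_Cu: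
  fixes f :: "'a::topological_ab_group_add \<Rightarrow> complex"
  assumes f: "f \<in> Cc" shows "f \<in> Cu"
proof -
  have "bounded (f ` supp f)"
    using continuous_on_subset[OF Cc_continuous[OF f] subset_UNIV] Cc_compact_supp[OF f]
    by (intro compact_imp_bounded compact_continuous_image)
  then obtain B where B: "\<And>x. x \<in> supp f \<Longrightarrow> norm (f x) \<le> B"
    by (auto simp: bounded_iff)
  show ?thesis
  proof (rule CuI)
    show "norm (f x) \<le> max B 0" for x
      using B[of x] supp_nonzero[of f x] by (cases "f x = 0") simp_all
    fix e :: real assume e: "e > 0"
    define W where "W x = (\<lambda>w. f (x + w)) -` ball (f x) (e/2)" for x
    \<comment> \<open>Halving without a metric: one summand accounts for b - x, the other for a -
      b.\<close>
    have "\<exists>V. open V \<and> 0 \<in> V \<and> (\<forall>a\<in>V. \<forall>b\<in>V. a + b \<in> W x)" for x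
    proof -
      have W: "open (W x)"
        unfolding W_def
      proof (rule open_vimage)
        show "continuous_on UNIV (\<lambda>w. f (x + w))"
          by (rule continuous_on_compose2[OF Cc_continuous[OF f]]) (intro continuous_intros, simp)
      qed simp
      have "open ((\<lambda>p. fst p + snd p) -` W x)"
        by (rule open_vimage[OF W]) (intro continuous_intros)
      moreover have "(0, 0) \<in> (\<lambda>p. fst p + snd p) -` W x"
        using e by (simp add: W_def)
      ultimately obtain A B where AB: "open A" "open B" "(0, 0) \<in> A \<times> B"
          "A \<times> B \<subseteq> (\<lambda>p. fst p + snd p) -` W x"
        by (rule open_prod_elim)
      then have "a + b \<in> W x" if "a \<in> A \<inter> B" "b \<in> A \<inter> B" for a b
        using that by force
      then show ?thesis
        using AB by (intro exI[of _ "A \<inter> B"]) auto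
    qed
    then obtain V where V: "\<And>x. open (V x)" "\<And>x. 0 \<in> V x" "\<And>x a b. a \<in> V x \<Longrightarrow> b \<in> V x \<Longrightarrow> a + b \<in> W x"
      by metis
    obtain D where D: "D \<subseteq> supp f" "finite D" "supp f \<subseteq> (\<Union>x\<in>D. (\<lambda>y. y - x) -` V x)"
    proof (rule compactE_image[OF Cc_compact_supp[OF f], of "supp f" "\<lambda>x. (\<lambda>y. y - x) -` V x"])
      show "open ((\<lambda>y. y - x) -` V x)" for x
        by (rule open_vimage[OF V(1)]) (intro continuous_intros)
      show "supp f \<subseteq> (\<Union>x\<in>supp f. (\<lambda>y. y - x) -` V x)"
        using V(2) by auto
    qed blast
    \<comment> \<open>Made symmetric so that the estimate, proved when \<open>b\<close> lies in the
      support, also covers the case that only \<open>a\<close> does.\<close>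
    define U where "U = (\<Inter>x\<in>D. V x \<inter> uminus -` V x)"
    have "open U"
      unfolding U_def using D(2) V(1) by (intro open_INT ballI open_Int open_vimage) (auto intro!: continuous_intros)
    moreover have "0 \<in> U"
      by (simp add: U_def V(2))
    moreover have *: "dist (f a) (f b) < e" if "b \<in> supp f" "a - b \<in> U" for a b
    proof -
      obtain x where x: "x \<in> D" "b - x \<in> V x"
        using D(3) \<open>b \<in> supp f\<close> by auto
      have "a - b \<in> V x"
        using that(2) x(1) by (auto simp: U_def)
      with x(2) have "(b - x) + (a - b) \<in> W x" "(b - x) + 0 \<in> W x"
        using V(2,3) by blast+
      then have "dist (f x) (f a) < e/2" "dist (f x) (f b) < e/2"
        by (simp_all add: W_def)
      then show ?thesis
        using dist_triangle_half_l[of "f a" "f x" e "f b"] by (simp add: dist_commute)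
    qed
    moreover have "dist (f a) (f b) < e" if "a - b \<in> U" for a b
    proof (cases "b \<in> supp f")
      case False
      show ?thesis
      proof (cases "a \<in> supp f")
        case True
        have "b - a \<in> U"
          using that by (auto simp: U_def)
        then show ?thesis
          using *[OF True, of b] by (simp add: dist_commute)
      next
        case False
        with \<open>b \<notin> supp f\<close> have "f a = 0" "f b = 0"
          using supp_nonzero[of f a] supp_nonzero[of f b] by argo+
        then show ?thesis using e by simp
      qed
    next
      case True
      then show ?thesis using *[OF True that] by simp
    qed
    ultimately show "\<exists>U. open U \<and> 0 \<in> U \<and> (\<forall>x y. x - y \<in> U \<longrightarrow> dist (f x) (f y) < e)"
      by blast
  qed
qed

section \<open>Haar integration\<close>

definition avg :: "'a measure \<Rightarrow> 'a set \<Rightarrow> ('a \<Rightarrow> complex) \<Rightarrow> complex" where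
  "avg \<theta> S u = (LINT t:S|\<theta>. u t) / complex_of_real (measure \<theta> S)"

locale haar =
  fixes \<theta> :: "'a::{topological_ab_group_add, t2_space} measure"
  assumes haar: "haar_measure \<theta>"
begin

lemma sets_haar [measurable_cong, simp]: "sets \<theta> = sets borel"
  using haar by (simp add: haar_measure_def)

lemma space_haar [simp]: "space \<theta> = UNIV"
  using sets_eq_imp_space_eq[OF sets_haar] by simp

lemma compact_sets: "compact S \<Longrightarrow> S \<in> sets \<theta>"
  by (simp add: compact_imp_closed)

lemma emeasure_compact: "compact S \<Longrightarrow> emeasure \<theta> S < \<infinity>"
  using haar by (simp add: haar_measure_def)

lemma measurable_continuous:
  fixes u :: "'a \<Rightarrow> 'b::topological_space"
  shows "continuous_on UNIV u \<Longrightarrow> u \<in> borel_measurable \<theta>"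
  by (simp add: measurable_cong_sets[OF sets_haar refl] borel_measurable_continuous_onI)

lemma measurable_translate: "(+) x \<in> measurable \<theta> \<theta>"
proof -
  have "continuous_on UNIV ((+) x)"
    by (intro continuous_intros)
  then show ?thesis
    by (simp add: measurable_cong_sets[OF sets_haar sets_haar] borel_measurable_continuous_onI)
qed

lemma translate_vimage: "(+) x -` B = (+) (- x) ` B" for x :: 'a
proof (intro set_eqI iffI)
  fix y assume "y \<in> (+) x -` B"
  then show "y \<in> (+) (- x) ` B"
    by (intro image_eqI[of _ _ "x + y"]) auto
qed auto

lemma translate_sets: "B \<in> sets borel \<Longrightarrow> (+) x ` B \<in> sets borel" for B :: "'a set"
  using measurable_sets[OF measurable_translate[of "- x"], of B] by (simp add: translate_vimage)

lemma emeasure_translate: "B \<in> sets borel \<Longrightarrow> emeasure \<theta> ((+) x ` B) = emeasure \<theta> B"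
  using haar by (simp add: haar_measure_def)

lemma measure_translate: "B \<in> sets borel \<Longrightarrow> measure \<theta> ((+) x ` B) = measure \<theta> B"
  by (simp add: measure_def emeasure_translate)

lemma distr_translate: "distr \<theta> \<theta> ((+) x) = \<theta>"
proof (rule measure_eqI)
  fix B assume "B \<in> sets (distr \<theta> \<theta> ((+) x))"
  then show "emeasure (distr \<theta> \<theta> ((+) x)) B = emeasure \<theta> B"
    using emeasure_translate[of B "- x"]
    by (simp add: emeasure_distr[OF measurable_translate] translate_vimage)
qed simp

lemma integral_translate:
  fixes f :: "'a \<Rightarrow> complex"
  assumes "f \<in> borel_measurable \<theta>"
  shows "(LINT t|\<theta>. f (x + t)) = (LINT t|\<theta>. f t)"
  using integral_distr[OF measurable_translate assms, of x] by (simp add: distr_translate)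

lemma set_integrable_mult:
  fixes u w :: "'a \<Rightarrow> complex"
  assumes u: "u \<in> bounded_cont" and w: "set_integrable \<theta> A w"
  shows "set_integrable \<theta> A (\<lambda>t. u t * w t)"
proof -
  obtain B where B: "\<And>x. norm (u x) \<le> B"
    using u by (auto simp: bounded_cont_def bounded_range_iff)
  have w': "integrable \<theta> (\<lambda>t. indicator A t *\<^sub>R w t)"
    using w by (simp add: set_integrable_def)
  have u': "u \<in> borel_measurable \<theta>"
    using u by (auto simp: bounded_cont_def intro: measurable_continuous)
  have eq: "indicator A t *\<^sub>R (u t * w t) = u t * (indicator A t *\<^sub>R w t)" for t
    by simp
  show ?thesis
    unfolding set_integrable_def eq
  proof (rule Bochner_Integration.integrable_bound)
    show "integrable \<theta> (\<lambda>t. complex_of_real B * (indicator A t *\<^sub>R w t))"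
      using w' by (rule integrable_mult_right)
    show "(\<lambda>t. u t * (indicator A t *\<^sub>R w t)) \<in> borel_measurable \<theta>"
      by (rule borel_measurable_times[OF u' borel_measurable_integrable[OF w']])
    show "AE t in \<theta>. norm (u t * (indicator A t *\<^sub>R w t))
        \<le> norm (complex_of_real B * (indicator A t *\<^sub>R w t))"
    proof (rule AE_I2)
      fix t
      have "norm (u t) \<le> norm (complex_of_real B)"
        using B[of t] by simp
      then show "norm (u t * (indicator A t *\<^sub>R w t)) \<le> norm (complex_of_real B * (indicator A t *\<^sub>R w t))"
        unfolding norm_mult by (intro mult_right_mono) auto
    qed
  qed
qed

lemma set_integrable_const: "compact A \<Longrightarrow> set_integrable \<theta> A (\<lambda>_. c :: complex)"
  unfolding set_integrable_def
  by (intro integrable_scaleR_left integrable_real_indicator compact_sets emeasure_compact)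

lemma set_integrable_compact:
  assumes "u \<in> bounded_cont" "compact A"
  shows "set_integrable \<theta> A u"
  using set_integrable_mult[OF assms(1) set_integrable_const[OF assms(2), of 1]] by simp

text \<open>Induction over the nodes makes the cover disjoint: the part of \<open>E\<close> in
  \<open>V t\<close> is assigned to the node \<open>t\<close>, with the integral of \<open>w\<close>
  over it as weight, and the rest of \<open>E\<close> is left to the other nodes. The weights do not
  depend on \<open>x\<close>, so the sum is a fixed combination of translates of \<open>e\<close>,
  on which an invariant functional can be evaluated. The map \<tau> allows both signs of the
  integration variable.\<close>

lemma riemann_cover:
  fixes w e :: "'a \<Rightarrow> complex" and \<tau> :: "'a \<Rightarrow> 'a"
  assumes e: "\<And>x. (\<lambda>s. e (x + \<tau> s)) \<in> bounded_cont"
    and V: "\<And>t. V t \<in> sets \<theta>" "\<And>x s t. s \<in> V t \<Longrightarrow> dist (e (x + \<tau> s)) (e (x + \<tau> t)) \<le> \<epsilon>"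
    and "finite D" "E \<in> sets \<theta>" "set_integrable \<theta> E w" "E \<subseteq> (\<Union>t\<in>D. V t)"
  shows "\<exists>v. (\<Sum>t\<in>D. v t) = (LINT s:E|\<theta>. w s) \<and>
    (\<forall>x. norm ((LINT s:E|\<theta>. e (x + \<tau> s) * w s) - (\<Sum>t\<in>D. e (x + \<tau> t) * v t))
      \<le> \<epsilon> * (LINT s:E|\<theta>. norm (w s)))"
  using assms(4-)
proof (induction D arbitrary: E rule: finite_induct)
  case empty
  then show ?case by (simp add: set_lebesgue_integral_def)
next
  case (insert t D)
  let ?P = "E \<inter> V t" and ?Q = "E - V t"
  have sets: "?P \<in> sets \<theta>" "?Q \<in> sets \<theta>"
    using insert.prems(1) V(1) by (blast intro: sets.Int sets.Diff)+
  have int: "set_integrable \<theta> ?P w" "set_integrable \<theta> ?Q w"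
    using sets by (auto intro: set_integrable_subset[OF insert.prems(2)])
  have split: "set_lebesgue_integral \<theta> E f = set_lebesgue_integral \<theta> ?P f + set_lebesgue_integral \<theta> ?Q f"
    if "set_integrable \<theta> ?P f" "set_integrable \<theta> ?Q f" for f :: "'a \<Rightarrow> 'b::{banach, second_countable_topology}"
    using set_integral_Un[of ?P ?Q \<theta> f] that by (auto simp: Un_Diff_Int Int_Diff_Un)
  have "?Q \<subseteq> (\<Union>t\<in>D. V t)"
    using insert.prems(3) by auto
  from insert.IH[OF sets(2) int(2) this] obtain v where
    v: "(\<Sum>t\<in>D. v t) = (LINT s:?Q|\<theta>. w s)"
      "\<And>x. norm ((LINT s:?Q|\<theta>. e (x + \<tau> s) * w s) - (\<Sum>t\<in>D. e (x + \<tau> t) * v t))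
        \<le> \<epsilon> * (LINT s:?Q|\<theta>. norm (w s))"
    by blast
  define v' where "v' = v(t := LINT s:?P|\<theta>. w s)"
  have sum_v': "(\<Sum>r\<in>insert t D. g r * v' r) = g t * (LINT s:?P|\<theta>. w s) + (\<Sum>r\<in>D. g r * v r)" for g
  proof -
    have "(\<Sum>r\<in>D. g r * v' r) = (\<Sum>r\<in>D. g r * v r)"
      using insert.hyps(2) by (intro sum.cong) (auto simp: v'_def)
    then show ?thesis
      using insert.hyps by (simp add: v'_def)
  qed
  have "(\<Sum>r\<in>insert t D. v' r) = (LINT s:E|\<theta>. w s)"
    using sum_v'[of "\<lambda>_. 1"] split[OF int] v(1) by simp
  moreover have "norm ((LINT s:E|\<theta>. e (x + \<tau> s) * w s) - (\<Sum>r\<in>insert t D. e (x + \<tau> r) * v' r))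
      \<le> \<epsilon> * (LINT s:E|\<theta>. norm (w s))" for x
  proof -
    let ?h = "\<lambda>s. e (x + \<tau> s) * w s" and ?c = "e (x + \<tau> t)"
    have h: "set_integrable \<theta> ?P ?h" "set_integrable \<theta> ?Q ?h"
      by (intro set_integrable_mult e int)+
    have c: "set_integrable \<theta> ?P (\<lambda>s. ?c * w s)"
      using int(1) by (simp add: set_integrable_mult_right)
    have hc: "set_integrable \<theta> ?P (\<lambda>s. ?h s - ?c * w s)"
      by (rule set_integral_diff(1)[OF h(1) c])
    have "norm ((LINT s:?P|\<theta>. ?h s) - ?c * (LINT s:?P|\<theta>. w s))
        = norm (LINT s:?P|\<theta>. ?h s - ?c * w s)"
      using set_integral_diff(2)[OF h(1) c] by simp
    also have "\<dots> \<le> (LINT s:?P|\<theta>. norm (?h s - ?c * w s))"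
      by (rule set_integral_norm_bound[OF hc])
    also have "\<dots> \<le> (LINT s:?P|\<theta>. \<epsilon> * norm (w s))"
    proof (rule set_integral_mono[OF set_integrable_norm[OF hc]])
      show "set_integrable \<theta> ?P (\<lambda>s. \<epsilon> * norm (w s))"
        using set_integrable_norm[OF int(1)] by (simp add: set_integrable_mult_right)
      fix s assume "s \<in> ?P"
      have "norm (?h s - ?c * w s) = dist (e (x + \<tau> s)) ?c * norm (w s)"
        by (simp add: dist_norm norm_mult[symmetric] left_diff_distrib)
      also have "\<dots> \<le> \<epsilon> * norm (w s)"
        using V(2) \<open>s \<in> ?P\<close> by (intro mult_right_mono) auto
      finally show "norm (?h s - ?c * w s) \<le> \<epsilon> * norm (w s)" .
    qed
    finally have 1: "norm ((LINT s:?P|\<theta>. ?h s) - ?c * (LINT s:?P|\<theta>. w s))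
        \<le> \<epsilon> * (LINT s:?P|\<theta>. norm (w s))"
      by simp
    have "(LINT s:E|\<theta>. ?h s) - (\<Sum>r\<in>insert t D. e (x + \<tau> r) * v' r) =
        ((LINT s:?P|\<theta>. ?h s) - ?c * (LINT s:?P|\<theta>. w s))
        + ((LINT s:?Q|\<theta>. ?h s) - (\<Sum>r\<in>D. e (x + \<tau> r) * v r))"
      using split[OF h] sum_v'[of "\<lambda>r. e (x + \<tau> r)"] by simp
    then have "norm ((LINT s:E|\<theta>. ?h s) - (\<Sum>r\<in>insert t D. e (x + \<tau> r) * v' r))
        \<le> \<epsilon> * (LINT s:?P|\<theta>. norm (w s)) + \<epsilon> * (LINT s:?Q|\<theta>. norm (w s))"
      using norm_triangle_mono[OF 1 v(2)[of x]] by simp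
    also have "\<dots> = \<epsilon> * (LINT s:E|\<theta>. norm (w s))"
      using split[OF set_integrable_norm[OF int(1)] set_integrable_norm[OF int(2)]]
      by (simp add: distrib_left)
    finally show ?thesis .
  qed
  ultimately show ?case by blast
qed

lemma bounded_cont_comp:
  fixes e :: "'a \<Rightarrow> complex"
  assumes "e \<in> bounded_cont" "continuous_on UNIV \<tau>"
  shows "(\<lambda>s. e (x + \<tau> s)) \<in> bounded_cont"
proof -
  have e: "continuous_on UNIV e"
    using assms(1) by (simp add: bounded_cont_def)
  have "continuous_on UNIV (\<lambda>s. x + \<tau> s)"
    using assms(2) by (intro continuous_on_add continuous_on_const)
  then have "continuous_on UNIV (\<lambda>s. e (x + \<tau> s))"
    by (rule continuous_on_compose2[OF e]) simp
  moreover have "bounded (range (\<lambda>s. e (x + \<tau> s)))"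
    by (rule bounded_subset[of "range e"]) (use assms(1) in \<open>auto simp: bounded_cont_def\<close>)
  ultimately show ?thesis
    by (simp add: bounded_cont_def)
qed

lemma riemann_approx:
  fixes w e :: "'a \<Rightarrow> complex" and \<tau> :: "'a \<Rightarrow> 'a"
  assumes e: "e \<in> Cu" and \<tau>: "continuous_on UNIV \<tau>" and A: "compact A"
    and w: "set_integrable \<theta> A w" and \<epsilon>: "\<epsilon> > 0"
  obtains D v where "finite D" "D \<subseteq> A" "(\<Sum>t\<in>D. v t) = (LINT s:A|\<theta>. w s)"
    "\<And>x. norm ((LINT s:A|\<theta>. e (x + \<tau> s) * w s) - (\<Sum>t\<in>D. e (x + \<tau> t) * v t))
      \<le> \<epsilon> * (LINT s:A|\<theta>. norm (w s))"
proof -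
  obtain U where U: "open U" "0 \<in> U" "\<And>x y. x - y \<in> U \<Longrightarrow> dist (e x) (e y) < \<epsilon>"
    using Cu_uniform[OF e \<epsilon>] by blast
  \<comment> \<open>The condition involves only the difference of the two arguments, in which
    \<open>x\<close> cancels; this makes the approximation uniform in \<open>x\<close>.\<close>
  define V where "V t = (\<lambda>s. \<tau> s - \<tau> t) -` U" for t
  have V_open: "open (V t)" for t
    unfolding V_def using U(1) \<tau> by (intro open_vimage continuous_on_diff continuous_on_const)
  obtain D where D: "D \<subseteq> A" "finite D" "A \<subseteq> (\<Union>t\<in>D. V t)"
  proof (rule compactE_image[OF A, of A V])
    show "A \<subseteq> (\<Union>t\<in>A. V t)"
      using U(2) by (auto simp: V_def)
  qed (use V_open in auto)
  have "\<exists>v. (\<Sum>t\<in>D. v t) = (LINT s:A|\<theta>. w s) \<and>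
    (\<forall>x. norm ((LINT s:A|\<theta>. e (x + \<tau> s) * w s) - (\<Sum>t\<in>D. e (x + \<tau> t) * v t))
      \<le> \<epsilon> * (LINT s:A|\<theta>. norm (w s)))"
  proof (rule riemann_cover)
    show "(\<lambda>s. e (x + \<tau> s)) \<in> bounded_cont" for x
      using e Cu_subset_bounded_cont \<tau> by (intro bounded_cont_comp) auto
    show "V t \<in> sets \<theta>" for t
      using V_open by simp
    show "dist (e (x + \<tau> s)) (e (x + \<tau> t)) \<le> \<epsilon>" if "s \<in> V t" for x s t
      using that U(3)[of "x + \<tau> s" "x + \<tau> t"] by (simp add: V_def)
  qed (use D A w compact_sets in auto)
  then show thesis
    using that D by blast
qed

section \<open>Averages\<close>

lemma avg_add:
  "u \<in> bounded_cont \<Longrightarrow> v \<in> bounded_cont \<Longrightarrow> compact S \<Longrightarrow>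
    avg \<theta> S (\<lambda>x. u x + v x) = avg \<theta> S u + avg \<theta> S v"
  by (simp add: avg_def set_integral_add set_integrable_compact add_divide_distrib)

lemma avg_scale: "avg \<theta> S (\<lambda>x. a * u x) = a * avg \<theta> S u"
  by (simp add: avg_def)

lemma avg_const:
  assumes "measure \<theta> S > 0" "compact S" shows "avg \<theta> S (\<lambda>_. a) = a"
proof -
  have "(LINT t:S|\<theta>. a) = complex_of_real (measure \<theta> S) * a"
    using assms by (simp add: set_lebesgue_integral_def compact_sets emeasure_compact scaleR_conv_of_real)
  then show ?thesis
    using assms by (simp add: avg_def)
qed

lemma avg_of_real: "avg \<theta> S (\<lambda>t. complex_of_real (r t)) = complex_of_real ((LINT t:S|\<theta>. r t) / measure \<theta> S)"
  by (simp add: avg_def set_integral_complex_of_real)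

text \<open>Real functions are kept embedded in the complex ones and read off by \<open>Re\<close>,
  because the limit functionals below act on complex functions; in this form the inequality passes
  to the limit.\<close>

lemma norm_avg_le:
  assumes "u \<in> bounded_cont" "compact S"
  shows "norm (avg \<theta> S u) \<le> Re (avg \<theta> S (\<lambda>t. complex_of_real (norm (u t))))"
  using set_integral_norm_bound[OF set_integrable_compact[OF assms]]
  by (simp add: avg_of_real) (simp add: avg_def norm_divide divide_right_mono)

lemma set_integrable_real:
  assumes "continuous_on UNIV r" "bounded (range r)" "compact S"
  shows "set_integrable \<theta> S (r :: 'a \<Rightarrow> real)"
proof -
  have "(\<lambda>t. complex_of_real (r t)) \<in> bounded_cont"
    using assms by (auto simp: bounded_cont_def bounded_iff intro!: continuous_intros)
  from set_integrable_compact[OF this assms(3)]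
  have "integrable \<theta> (\<lambda>t. Re (indicator S t *\<^sub>R complex_of_real (r t)))"
    unfolding set_integrable_def by (rule integrable_Re)
  then show ?thesis by (simp add: set_integrable_def)
qed

lemma avg_mono:
  fixes a b :: "'a \<Rightarrow> real"
  assumes "continuous_on UNIV a" "bounded (range a)" "continuous_on UNIV b" "bounded (range b)"
    and "compact S" "\<And>t. a t \<le> b t"
  shows "Re (avg \<theta> S (\<lambda>t. of_real (a t))) \<le> Re (avg \<theta> S (\<lambda>t. of_real (b t)))"
  unfolding avg_of_real using assms
  by (auto intro!: divide_right_mono set_integral_mono set_integrable_real)

lemma norm_avg_bound:
  assumes "u \<in> bounded_cont" "compact S" "\<And>x. norm (u x) \<le> M"
  shows "norm (avg \<theta> S u) \<le> M"
proof (cases "measure \<theta> S > 0")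
  case True
  have "continuous_on UNIV (\<lambda>t. norm (u t))" "bounded (range (\<lambda>t. norm (u t)))"
    using assms(1) by (auto simp: bounded_cont_def bounded_iff intro!: continuous_intros)
  then have "Re (avg \<theta> S (\<lambda>t. of_real (norm (u t)))) \<le> Re (avg \<theta> S (\<lambda>t. of_real M))"
    using assms by (intro avg_mono) auto
  then show ?thesis
    using norm_avg_le[OF assms(1,2)] avg_const[OF True assms(2), of "of_real M"] by simp
next
  \<comment> \<open>The average is then 0 by the convention for division, and only
    \<open>0 \<le> M\<close> is left to show.\<close>
  case False
  then have "measure \<theta> S = 0"
    using measure_nonneg[of \<theta> S] by linarith
  then show ?thesis
    using order_trans[OF norm_ge_zero assms(3)] by (simp add: avg_def)
qed

lemma avg_translate:
  assumes u: "u \<in> bounded_cont" and S: "compact S"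
  shows "avg \<theta> ((+) x ` S) u = avg \<theta> S (\<lambda>t. u (x + t))"
proof -
  let ?f = "\<lambda>t. indicator ((+) x ` S) t *\<^sub>R u t"
  have "?f \<in> borel_measurable \<theta>"
    using u translate_sets[of S x] compact_sets[OF S]
    by (intro borel_measurable_scaleR borel_measurable_indicator measurable_continuous)
      (auto simp: bounded_cont_def)
  from integral_translate[OF this, of x]
  have "(LINT t:(+) x ` S|\<theta>. u t) = (LINT t|\<theta>. ?f (x + t))"
    by (simp add: set_lebesgue_integral_def)
  also have "\<dots> = (LINT t:S|\<theta>. u (x + t))"
    unfolding set_lebesgue_integral_def
    by (rule Bochner_Integration.integral_cong) (auto simp: indicator_def)
  finally have "(LINT t:(+) x ` S|\<theta>. u t) = (LINT t:S|\<theta>. u (x + t))" .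
  moreover have "measure \<theta> ((+) x ` S) = measure \<theta> S"
    using compact_sets[OF S] by (intro measure_translate) simp
  ultimately show ?thesis
    by (simp only: avg_def)
qed

text \<open>Shifting the function is the same as shifting the set, and the two integrals differ only
  over the symmetric difference. This is the Folner ratio times the bound of
  \<open>u\<close>.\<close>

lemma avg_translate_diff:
  assumes u: "u \<in> bounded_cont" and S: "compact S" and M: "\<And>t. norm (u t) \<le> M"
  shows "norm (avg \<theta> S (\<lambda>t. u (x + t)) - avg \<theta> S u)
    \<le> M * (measure \<theta> (sym_diff S ((+) x ` S)) / measure \<theta> S)"
proof -
  let ?S = "(+) x ` S" and ?D = "sym_diff S ((+) x ` S)"
  have S': "compact ?S"
    using S by (intro compact_continuous_image continuous_intros)
  have D: "?D \<in> sets \<theta>" "emeasure \<theta> ?D < \<infinity>"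
  proof -
    show D: "?D \<in> sets \<theta>"
      using compact_sets[OF S] compact_sets[OF S'] by (intro sets.Un sets.Diff)
    have "emeasure \<theta> ?D \<le> emeasure \<theta> (S \<union> ?S)"
      using compact_sets[OF S] compact_sets[OF S'] by (intro emeasure_mono sets.Un) auto
    also have "\<dots> < \<infinity>"
      by (rule emeasure_compact[OF compact_Un[OF S S']])
    finally show "emeasure \<theta> ?D < \<infinity>" .
  qed
  have int: "integrable \<theta> (\<lambda>t. indicator ?S t *\<^sub>R u t)" "integrable \<theta> (\<lambda>t. indicator S t *\<^sub>R u t)"
    using set_integrable_compact[OF u S'] set_integrable_compact[OF u S] by (simp_all add: set_integrable_def)
  have "norm ((LINT t:?S|\<theta>. u t) - (LINT t:S|\<theta>. u t))
      = norm (LINT t|\<theta>. indicator ?S t *\<^sub>R u t - indicator S t *\<^sub>R u t)"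
    using int by (simp add: set_lebesgue_integral_def)
  also have "\<dots> \<le> (LINT t|\<theta>. norm (indicator ?S t *\<^sub>R u t - indicator S t *\<^sub>R u t))"
    by (rule integral_norm_bound)
  also have "\<dots> \<le> (LINT t|\<theta>. M * indicator ?D t)"
  proof (rule integral_mono)
    show "integrable \<theta> (\<lambda>t. norm (indicator ?S t *\<^sub>R u t - indicator S t *\<^sub>R u t))"
      using int by (intro integrable_norm Bochner_Integration.integrable_diff)
    show "integrable \<theta> (\<lambda>t. M * indicator ?D t :: real)"
      using D by (intro integrable_mult_right) (simp add: integrable_indicator_iff)
    show "norm (indicator ?S t *\<^sub>R u t - indicator S t *\<^sub>R u t) \<le> M * indicator ?D t" for t
      using M[of t] by (cases "t \<in> S"; cases "t \<in> ?S") (simp_all add: norm_minus_commute)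
  qed
  also have "\<dots> = M * measure \<theta> ?D"
    using D by simp
  finally have "norm ((LINT t:?S|\<theta>. u t) - (LINT t:S|\<theta>. u t)) \<le> M * measure \<theta> ?D" .
  moreover have "measure \<theta> ?S = measure \<theta> S"
    using compact_sets[OF S] by (intro measure_translate) simp
  then have "avg \<theta> S (\<lambda>t. u (x + t)) - avg \<theta> S u
      = ((LINT t:?S|\<theta>. u t) - (LINT t:S|\<theta>. u t)) / complex_of_real (measure \<theta> S)"
    unfolding avg_translate[OF u S, symmetric] by (simp add: avg_def diff_divide_distrib)
  ultimately show ?thesis
    by (simp add: norm_divide divide_right_mono)
qed

end

section \<open>Means along Folner sequences\<close>

text \<open>\<phi> is a cluster point of the averages for pointwise convergence on
  \<open>bounded_cont\<close>. Finite sets \<open>F\<close> occur because linearity, positivity and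
  invariance each compare several functions, whose averages must converge along the same
  indices.\<close>

definition limit_mean ::
    "'a::topological_space measure \<Rightarrow> (nat \<Rightarrow> 'a set) \<Rightarrow> (('a \<Rightarrow> complex) \<Rightarrow> complex) \<Rightarrow> bool" where
  "limit_mean \<theta> A \<phi> \<longleftrightarrow> (\<forall>F e N. finite F \<longrightarrow> F \<subseteq> bounded_cont \<longrightarrow> e > 0 \<longrightarrow>
     (\<exists>n\<ge>N. \<forall>u\<in>F. dist (avg \<theta> (A n) u) (\<phi> u) < e))"

context haar
begin

text \<open>Tychonoff: the averages are points of a product of closed discs with radii
  \<open>sup_norm u\<close>, and any point common to the closures of all tails will do.\<close>

lemma limit_mean_exists:
  assumes A: "\<And>n. compact (A n)"
  obtains \<phi> where "limit_mean \<theta> A \<phi>"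
proof -
  let ?X = "product_topology (\<lambda>u. top_of_set (cball (0::complex) (sup_norm u))) (bounded_cont :: ('a \<Rightarrow> complex) set)"
  define q where "q n = restrict (avg \<theta> (A n)) bounded_cont" for n
  let ?C = "\<lambda>N. ?X closure_of (q ` {N..})"
  have q: "q n \<in> topspace ?X" for n
    using A by (auto simp: q_def bounded_cont_def intro!: norm_avg_bound norm_le_sup_norm)
  have "\<Inter> (range ?C) \<noteq> {}"
  proof (rule compact_space_imp_nest)
    show "compact_space ?X"
      unfolding compact_space_product_topology
      by (intro disjI2 ballI compact_space_subtopology) simp
    show "?C N \<noteq> {}" for N
    proof -
      have "q N \<in> topspace ?X \<inter> q ` {N..}"
        using q by blast
      then show ?thesis
        by (auto simp: closure_of_eq_empty_gen disjnt_iff simp del: topspace_product_topology)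
    qed
    show "antimono_on UNIV ?C"
      by (intro antimonoI closure_of_mono image_mono) auto
  qed simp
  then obtain \<phi> where \<phi>: "\<And>N. \<phi> \<in> ?C N"
    by auto
  have "\<exists>n\<ge>N. \<forall>u\<in>F. dist (avg \<theta> (A n) u) (\<phi> u) < e"
    if F: "finite F" "F \<subseteq> bounded_cont" and e: "e > 0" for F e N
  proof -
    let ?W = "(\<Inter>u\<in>F. {y \<in> topspace ?X. y u \<in> ball (\<phi> u) e}) \<inter> topspace ?X"
    have "openin ?X ?W"
    proof (rule openin_INT[OF F(1)])
      fix u assume "u \<in> F"
      then have "u \<in> bounded_cont" using F by blast
      then have "continuous_map ?X (top_of_set (cball 0 (sup_norm u))) (\<lambda>y. y u)"
        by (rule continuous_map_product_projection)
      then have "continuous_map ?X euclidean (\<lambda>y. y u)"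
        by (rule continuous_map_into_fulltopology)
      from openin_continuous_map_preimage[OF this, of "ball (\<phi> u) e"]
      show "openin ?X {y \<in> topspace ?X. y u \<in> ball (\<phi> u) e}" by simp
    qed
    moreover have "\<phi> \<in> topspace ?X"
      using \<phi>[of 0] by (simp only: in_closure_of)
    then have "\<phi> \<in> ?W"
      using e by auto
    ultimately obtain y where "y \<in> q ` {N..}" "y \<in> ?W"
      using \<phi>[of N] unfolding in_closure_of by meson
    then obtain n where n: "n \<ge> N" "q n \<in> ?W"
      by auto
    have "dist (avg \<theta> (A n) u) (\<phi> u) < e" if "u \<in> F" for u
    proof -
      have "q n u \<in> ball (\<phi> u) e"
        using n(2) that by blast
      moreover have "q n u = avg \<theta> (A n) u"
        using that F(2) by (auto simp: q_def)
      ultimately show ?thesis by (simp add: dist_commute)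
    qed
    with n(1) show ?thesis by blast
  qed
  then show thesis
    by (intro that[of \<phi>]) (simp add: limit_mean_def)
qed

section \<open>Operations on Folner sequences\<close>

lemma folner_compact: "folner \<theta> A \<Longrightarrow> compact (A n)"
  by (simp add: folner_def)

lemma folner_pos: "folner \<theta> A \<Longrightarrow> measure \<theta> (A n) > 0"
  by (simp add: folner_def)

lemma folner_tendsto:
  "folner \<theta> A \<Longrightarrow> (\<lambda>n. measure \<theta> (sym_diff (A n) ((+) x ` A n)) / measure \<theta> (A n)) \<longlonglongrightarrow> 0"
  by (simp add: folner_def)

lemma folner_subseq:
  assumes "folner \<theta> A" "strict_mono r" shows "folner \<theta> (\<lambda>n. A (r n))"
  unfolding folner_def
  using LIMSEQ_subseq_LIMSEQ[OF folner_tendsto[OF assms(1)] assms(2)]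
    folner_compact[OF assms(1)] folner_pos[OF assms(1)]
  by (simp add: o_def)

text \<open>The shifts may vary with \<open>n\<close> in any way, since invariance leaves every
  ratio unchanged. This is what turns convergence of averages into convergence uniform over
  translates.\<close>

lemma folner_translate:
  assumes A: "folner \<theta> A" shows "folner \<theta> (\<lambda>n. (+) (y n) ` A n)"
proof -
  note S = compact_sets[OF folner_compact[OF A]]
  have eq: "measure \<theta> ((+) (y n) ` A n) = measure \<theta> (A n)" for n
    using S[of n] by (intro measure_translate) simp
  have "measure \<theta> (sym_diff ((+) (y n) ` A n) ((+) x ` (+) (y n) ` A n))
      = measure \<theta> (sym_diff (A n) ((+) x ` A n))" for n x
  proof -
    have "(+) x ` (+) (y n) ` A n = (+) (y n) ` (+) x ` A n"
      by (simp add: image_image add.left_commute)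
    then have "sym_diff ((+) (y n) ` A n) ((+) x ` (+) (y n) ` A n)
        = (+) (y n) ` sym_diff (A n) ((+) x ` A n)"
      by (simp add: image_Un image_set_diff)
    then show ?thesis
      using S[of n] translate_sets[of "A n" x] by (simp add: measure_translate)
  qed
  moreover have "compact ((+) (y n) ` A n)" for n
    using folner_compact[OF A] by (intro compact_continuous_image continuous_intros)
  ultimately show ?thesis
    using A by (simp add: folner_def eq)
qed

lemma avg_dual:
  assumes "compact S" shows "avg \<theta> S \<in> Cu_dual"
proof (rule Cu_dualI)
  show "avg \<theta> S (\<lambda>x. f x + g x) = avg \<theta> S f + avg \<theta> S g" if "f \<in> Cu" "g \<in> Cu" for f g
    using that assms Cu_subset_bounded_cont by (intro avg_add) auto
  show "norm (avg \<theta> S f) \<le> 1 * sup_norm f" if "f \<in> Cu" for f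
  proof -
    have "norm (avg \<theta> S f) \<le> sup_norm f"
      using that assms Cu_subset_bounded_cont norm_le_sup_norm[OF Cu_bounded[OF that]]
      by (intro norm_avg_bound) auto
    then show ?thesis by simp
  qed
qed (rule avg_scale)

lemma Cu_avg:
  assumes f: "f \<in> Cu" and S: "compact S"
  shows "(\<lambda>s. avg \<theta> S (\<lambda>t. f (s + t))) \<in> Cu"
proof (rule CuI)
  have shift: "(\<lambda>t. f (s + t)) \<in> Cu" for s
    using Cu_shift[OF f, of s] by (simp add: add.commute)
  have bc: "u \<in> bounded_cont" if "u \<in> Cu" for u :: "'a \<Rightarrow> complex"
    using that Cu_subset_bounded_cont by auto
  show "norm (avg \<theta> S (\<lambda>t. f (s + t))) \<le> sup_norm f" for s
    using S norm_le_sup_norm[OF Cu_bounded[OF f]] by (intro norm_avg_bound bc shift)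
  fix e :: real assume "e > 0"
  then have "e/2 > 0" by simp
  then obtain U where U: "open U" "0 \<in> U" "\<And>x y. x - y \<in> U \<Longrightarrow> dist (f x) (f y) < e/2"
    using Cu_uniform[OF f] by blast
  have "dist (avg \<theta> S (\<lambda>t. f (x + t))) (avg \<theta> S (\<lambda>t. f (y + t))) < e" if "x - y \<in> U" for x y
  proof -
    have "norm (f (x + t) - f (y + t)) \<le> e/2" for t
      using U(3)[of "x + t" "y + t"] that by (simp add: dist_norm)
    moreover have "(\<lambda>t. f (x + t) - f (y + t)) \<in> Cu"
      using Cu_add[OF shift[of x] Cu_scale[OF shift[of y], of "-1"]] by simp
    ultimately have "norm (avg \<theta> S (\<lambda>t. f (x + t) - f (y + t))) \<le> e/2"
      using S by (intro norm_avg_bound bc)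
    then show ?thesis
      using Cu_dual_diff[OF avg_dual[OF S] shift shift, of x y] \<open>e > 0\<close> by (simp add: dist_norm)
  qed
  then show "\<exists>U. open U \<and> 0 \<in> U \<and> (\<forall>x y. x - y \<in> U \<longrightarrow>
      dist (avg \<theta> S (\<lambda>t. f (x + t))) (avg \<theta> S (\<lambda>t. f (y + t))) < e)"
    using U by blast
qed

end

text \<open>Interpreted both for the sequence given in the theorem and, in
  \<open>avg_orbit_closure\<close>, for a subsequence along which averages are supposed to
  misbehave.\<close>

locale folner_mean = haar \<theta>
  for \<theta> :: "'a::{topological_ab_group_add, t2_space} measure" +
  fixes A :: "nat \<Rightarrow> 'a set" and \<phi> :: "('a \<Rightarrow> complex) \<Rightarrow> complex"
  assumes folner: "folner \<theta> A" and limit: "limit_mean \<theta> A \<phi>"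
begin

text \<open>One index sequence serves all of \<open>F\<close>, so algebraic relations and
  inequalities between averages pass to \<phi>. It tends to infinity, which keeps the Folner ratios
  tending to 0.\<close>

lemma mean_limit:
  assumes "finite F" "F \<subseteq> bounded_cont"
  obtains r where "filterlim r at_top sequentially"
    "\<And>u. u \<in> F \<Longrightarrow> (\<lambda>n. avg \<theta> (A (r n)) u) \<longlonglongrightarrow> \<phi> u"
proof -
  have "\<exists>n\<ge>N. \<forall>u\<in>F. dist (avg \<theta> (A n) u) (\<phi> u) < inverse (real (Suc N))" for N
    using limit assms by (simp add: limit_mean_def)
  then obtain r where r: "\<And>N. r N \<ge> N"
      "\<And>N u. u \<in> F \<Longrightarrow> dist (avg \<theta> (A (r N)) u) (\<phi> u) < inverse (real (Suc N))"
    by metis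
  have "filterlim r at_top sequentially"
    using filterlim_at_top_mono[OF filterlim_ident, of r] r(1) by auto
  moreover have "(\<lambda>n. avg \<theta> (A (r n)) u) \<longlonglongrightarrow> \<phi> u" if "u \<in> F" for u
  proof -
    have "(\<lambda>n. dist (avg \<theta> (A (r n)) u) (\<phi> u)) \<longlonglongrightarrow> 0"
      by (rule tendsto_sandwich[OF _ _ tendsto_const LIMSEQ_inverse_real_of_nat])
        (use r(2)[OF that] in \<open>auto intro!: always_eventually less_imp_le\<close>)
    then show ?thesis by (subst tendsto_dist_iff)
  qed
  ultimately show thesis by (rule that)
qed

lemma mean_closed:
  assumes u: "u \<in> bounded_cont" and C: "closed C" "\<And>n. avg \<theta> (A n) u \<in> C"
  shows "\<phi> u \<in> C"
proof -
  obtain r where "(\<lambda>n. avg \<theta> (A (r n)) u) \<longlonglongrightarrow> \<phi> u"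
    using mean_limit[of "{u}"] u by auto
  then show ?thesis
    using C by (intro Lim_in_closed_set[of C]) auto
qed

lemma mean_eq_limit:
  assumes "u \<in> bounded_cont" "(\<lambda>n. avg \<theta> (A n) u) \<longlonglongrightarrow> a"
  shows "\<phi> u = a"
proof -
  obtain r where r: "filterlim r at_top sequentially" "(\<lambda>n. avg \<theta> (A (r n)) u) \<longlonglongrightarrow> \<phi> u"
    using mean_limit[of "{u}"] assms by auto
  then show ?thesis
    using LIMSEQ_unique filterlim_compose[OF assms(2) r(1)] by blast
qed

lemma mean_add:
  assumes u: "u \<in> bounded_cont" and v: "v \<in> bounded_cont"
  shows "\<phi> (\<lambda>x. u x + v x) = \<phi> u + \<phi> v"
proof -
  obtain r where r: "\<And>w. w \<in> {u, v, \<lambda>x. u x + v x} \<Longrightarrow> (\<lambda>n. avg \<theta> (A (r n)) w) \<longlonglongrightarrow> \<phi> w"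
    using mean_limit[of "{u, v, \<lambda>x. u x + v x}"] u v bounded_cont_add[OF u v] by auto
  have "(\<lambda>n. avg \<theta> (A (r n)) (\<lambda>x. u x + v x)) \<longlonglongrightarrow> \<phi> u + \<phi> v"
    using tendsto_add[OF r[of u] r[of v]] by (simp add: avg_add[OF u v folner_compact[OF folner]])
  then show ?thesis
    using LIMSEQ_unique r by blast
qed

lemma mean_scale:
  assumes u: "u \<in> bounded_cont"
  shows "\<phi> (\<lambda>x. a * u x) = a * \<phi> u"
proof -
  obtain r where r: "\<And>w. w \<in> {u, \<lambda>x. a * u x} \<Longrightarrow> (\<lambda>n. avg \<theta> (A (r n)) w) \<longlonglongrightarrow> \<phi> w"
    using mean_limit[of "{u, \<lambda>x. a * u x}"] u bounded_cont_scale[OF u, of a] by auto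
  have "(\<lambda>n. avg \<theta> (A (r n)) (\<lambda>x. a * u x)) \<longlonglongrightarrow> a * \<phi> u"
    using tendsto_mult[OF tendsto_const r[of u]] by (simp add: avg_scale)
  then show ?thesis
    using LIMSEQ_unique r by blast
qed

lemma mean_const: "\<phi> (\<lambda>_. a) = a"
  by (rule mean_eq_limit) (auto simp: bounded_cont_def avg_const folner_pos[OF folner] folner_compact[OF folner])

lemma mean_bound:
  assumes "u \<in> bounded_cont" "\<And>x. norm (u x) \<le> M"
  shows "norm (\<phi> u) \<le> M"
proof -
  have "\<phi> u \<in> cball 0 M"
    by (rule mean_closed[OF assms(1)]) (auto intro!: norm_avg_bound assms folner_compact[OF folner])
  then show ?thesis by simp
qed

lemma norm_mean_le:
  assumes u: "u \<in> bounded_cont"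
  shows "norm (\<phi> u) \<le> Re (\<phi> (\<lambda>t. complex_of_real (norm (u t))))"
proof -
  let ?v = "\<lambda>t. complex_of_real (norm (u t))"
  have v: "?v \<in> bounded_cont"
    by (rule bounded_cont_of_real[OF bounded_cont_norm[OF u]])
  obtain r where r: "\<And>w. w \<in> {u, ?v} \<Longrightarrow> (\<lambda>n. avg \<theta> (A (r n)) w) \<longlonglongrightarrow> \<phi> w"
    using mean_limit[of "{u, ?v}"] u v by auto
  show ?thesis
    by (rule LIMSEQ_le[OF tendsto_norm[OF r[of u]] tendsto_Re[OF r[of ?v]]])
      (auto intro!: norm_avg_le u folner_compact[OF folner])
qed

lemma mean_mono:
  fixes a b :: "'a \<Rightarrow> real"
  assumes a: "continuous_on UNIV a" "bounded (range a)" and b: "continuous_on UNIV b" "bounded (range b)"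
    and le: "\<And>t. a t \<le> b t"
  shows "Re (\<phi> (\<lambda>t. of_real (a t))) \<le> Re (\<phi> (\<lambda>t. of_real (b t)))"
proof -
  let ?u = "\<lambda>t. complex_of_real (a t)" and ?v = "\<lambda>t. complex_of_real (b t)"
  obtain r where r: "\<And>w. w \<in> {?u, ?v} \<Longrightarrow> (\<lambda>n. avg \<theta> (A (r n)) w) \<longlonglongrightarrow> \<phi> w"
    using mean_limit[of "{?u, ?v}"] bounded_cont_of_real[OF a] bounded_cont_of_real[OF b] by auto
  show ?thesis
    by (rule LIMSEQ_le[OF tendsto_Re[OF r[of ?u]] tendsto_Re[OF r[of ?v]]])
      (auto intro!: exI[of _ 0] avg_mono a b le folner_compact[OF folner] simp del: Re_complex_of_real)
qed

lemma mean_shift: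
  assumes u: "u \<in> bounded_cont"
  shows "\<phi> (\<lambda>t. u (x + t)) = \<phi> u"
proof -
  let ?v = "\<lambda>t. u (x + t)"
  obtain M where M: "\<And>t. norm (u t) \<le> M"
    using u by (auto simp: bounded_cont_def bounded_range_iff)
  have v: "?v \<in> bounded_cont"
    using bounded_cont_comp[OF u continuous_on_id] by simp
  obtain r where r: "filterlim r at_top sequentially"
      "\<And>w. w \<in> {u, ?v} \<Longrightarrow> (\<lambda>n. avg \<theta> (A (r n)) w) \<longlonglongrightarrow> \<phi> w"
    using mean_limit[of "{u, ?v}"] u v by auto
  have "(\<lambda>n. M * (measure \<theta> (sym_diff (A (r n)) ((+) x ` A (r n))) / measure \<theta> (A (r n)))) \<longlonglongrightarrow> M * 0"
    by (intro tendsto_mult tendsto_const filterlim_compose[OF folner_tendsto[OF folner] r(1)])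
  then have lim: "(\<lambda>n. M * (measure \<theta> (sym_diff (A (r n)) ((+) x ` A (r n))) / measure \<theta> (A (r n)))) \<longlonglongrightarrow> 0"
    by simp
  have "(\<lambda>n. avg \<theta> (A (r n)) ?v - avg \<theta> (A (r n)) u) \<longlonglongrightarrow> 0"
    by (rule Lim_null_comparison[OF _ lim])
      (intro always_eventually allI avg_translate_diff[OF u folner_compact[OF folner] M])
  moreover have "(\<lambda>n. avg \<theta> (A (r n)) ?v - avg \<theta> (A (r n)) u) \<longlonglongrightarrow> \<phi> ?v - \<phi> u"
    by (intro tendsto_diff r(2)) auto
  ultimately have "0 = \<phi> ?v - \<phi> u"
    by (rule LIMSEQ_unique)
  then show ?thesis by simp
qed

lemma mean_dual: "\<phi> \<in> Cu_dual"
proof (rule Cu_dualI)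
  show "\<phi> (\<lambda>x. f x + g x) = \<phi> f + \<phi> g" if "f \<in> Cu" "g \<in> Cu" for f g
    using that Cu_subset_bounded_cont by (intro mean_add) auto
  show "\<phi> (\<lambda>x. a * f x) = a * \<phi> f" if "f \<in> Cu" for a f
    using that Cu_subset_bounded_cont by (intro mean_scale) auto
  show "norm (\<phi> f) \<le> 1 * sup_norm f" if "f \<in> Cu" for f
  proof -
    have "norm (\<phi> f) \<le> sup_norm f"
      using that Cu_subset_bounded_cont norm_le_sup_norm[OF Cu_bounded[OF that]]
      by (intro mean_bound) auto
    then show ?thesis by simp
  qed
qed

lemma mean_translate:
  assumes "u \<in> bounded_cont" shows "\<phi> (translate_fun t u) = \<phi> u"
  using mean_shift[OF assms, of "- t"] by (simp add: translate_fun_def)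

lemma mean_sum:
  assumes "\<And>i. i \<in> I \<Longrightarrow> u i \<in> Cu"
  shows "(\<lambda>x. \<Sum>i\<in>I. u i x) \<in> Cu \<and> \<phi> (\<lambda>x. \<Sum>i\<in>I. u i x) = (\<Sum>i\<in>I. \<phi> (u i))"
  using assms
  by (induction I rule: infinite_finite_induct)
    (auto simp: mean_const Cu_const intro: Cu_add Cu_dual_add[OF mean_dual, THEN trans])

text \<open>An exchange of \<phi> with a Haar integral, by Riemann sums: the average is uniformly
  close to a combination of translates of \<open>f\<close> with weights of sum 1, and \<phi> takes
  the value \<open>\<phi> f\<close> on each translate.\<close>

lemma mean_avg:
  assumes f: "f \<in> Cu" and S: "compact S" "measure \<theta> S > 0"
  shows "\<phi> (\<lambda>s. avg \<theta> S (\<lambda>t. f (s + t))) = \<phi> f"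
proof -
  let ?g = "\<lambda>s. avg \<theta> S (\<lambda>t. f (s + t))"
  have g: "?g \<in> Cu"
    by (rule Cu_avg[OF f S(1)])
  have "norm (\<phi> ?g - \<phi> f) \<le> 0 + \<epsilon>" if \<epsilon>: "\<epsilon> > 0" for \<epsilon>
  proof -
    let ?m = "complex_of_real (measure \<theta> S)"
    obtain D v where D: "finite D" "D \<subseteq> S" "(\<Sum>t\<in>D. v t) = (LINT s:S|\<theta>. 1)"
      "\<And>x. norm ((LINT s:S|\<theta>. f (x + s) * 1) - (\<Sum>t\<in>D. f (x + t) * v t))
        \<le> \<epsilon> * (LINT s:S|\<theta>. norm (1::complex))"
      using riemann_approx[OF f continuous_on_id S(1) set_integrable_const[OF S(1)] \<epsilon>, of 1] by blast
    have int1: "(LINT s:S|\<theta>. 1) = ?m" "(LINT s:S|\<theta>. norm (1::complex)) = measure \<theta> S"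
      using S by (simp_all add: set_lebesgue_integral_def compact_sets emeasure_compact scaleR_conv_of_real)
    let ?h = "\<lambda>x. \<Sum>t\<in>D. (v t / ?m) * f (x + t)"
    have h: "?h \<in> Cu \<and> \<phi> ?h = (\<Sum>t\<in>D. \<phi> (\<lambda>x. (v t / ?m) * f (x + t)))"
      by (rule mean_sum) (intro Cu_scale Cu_shift f)
    have "\<phi> (\<lambda>x. (v t / ?m) * f (x + t)) = (v t / ?m) * \<phi> f" for t
      using Cu_dual_scale[OF mean_dual Cu_shift[OF f], of "v t / ?m" t] mean_shift[of f t]
        f Cu_subset_bounded_cont by (auto simp: add.commute)
    then have "\<phi> ?h = (\<Sum>t\<in>D. v t / ?m) * \<phi> f"
      using h by (simp add: sum_distrib_right)
    also have "(\<Sum>t\<in>D. v t / ?m) = 1"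
      using D(3) S(2) by (simp add: sum_divide_distrib[symmetric] int1)
    finally have \<phi>h: "\<phi> ?h = \<phi> f" by simp
    have "norm (?g x - ?h x) \<le> \<epsilon>" for x
    proof -
      have "?g x - ?h x = ((LINT s:S|\<theta>. f (x + s) * 1) - (\<Sum>t\<in>D. f (x + t) * v t)) / ?m"
        by (simp add: avg_def diff_divide_distrib sum_divide_distrib mult.commute)
      then have "norm (?g x - ?h x)
          = norm ((LINT s:S|\<theta>. f (x + s) * 1) - (\<Sum>t\<in>D. f (x + t) * v t)) / measure \<theta> S"
        by (simp add: norm_divide)
      also have "\<dots> \<le> \<epsilon> * measure \<theta> S / measure \<theta> S"
        using D(4)[of x] unfolding int1(2) by (intro divide_right_mono) simp_all
      finally have "norm (?g x - ?h x) \<le> \<epsilon> * measure \<theta> S / measure \<theta> S" .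
      then show ?thesis using S(2) by simp
    qed
    moreover have "(\<lambda>x. ?g x - ?h x) \<in> Cu"
      using Cu_add[OF g Cu_scale[of ?h "-1"]] h by simp
    ultimately have "norm (\<phi> (\<lambda>x. ?g x - ?h x)) \<le> \<epsilon>"
      using Cu_subset_bounded_cont by (intro mean_bound) auto
    then show ?thesis
      unfolding Cu_dual_diff[OF mean_dual g conjunct1[OF h]] \<phi>h by simp
  qed
  then have "norm (\<phi> ?g - \<phi> f) \<le> 0"
    by (rule field_le_epsilon)
  then show ?thesis by simp
qed

end

section \<open>The mean of a weakly almost periodic function\<close>

context haar
begin

text \<open>If the averages of \<open>g\<close> stayed away from \<open>a\<close> along a
  subsequence, a limit functional \<psi> of that subsequence would equal \<open>a\<close> on the
  whole orbit of \<open>f\<close>, hence at \<open>g\<close> by weak continuity, although \<psi> g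
  keeps distance \<open>e\<close> from \<open>a\<close>.\<close>

lemma avg_orbit_closure:
  assumes f: "f \<in> Cu" and B: "folner \<theta> B" and lim: "(\<lambda>n. avg \<theta> (B n) f) \<longlonglongrightarrow> a"
    and g: "g \<in> orbit_closure f"
  shows "(\<lambda>n. avg \<theta> (B n) g) \<longlonglongrightarrow> a"
proof (rule tendstoI, rule ccontr)
  fix e :: real assume e: "e > 0"
  assume ne: "\<not> (\<forall>\<^sub>F n in sequentially. dist (avg \<theta> (B n) g) a < e)"
  from not_eventually_sequentiallyD[OF ne]
  obtain r :: "nat \<Rightarrow> nat" where r: "strict_mono r" "\<forall>n. \<not> dist (avg \<theta> (B (r n)) g) a < e"
    by (elim exE conjE)
  have C: "folner \<theta> (\<lambda>n. B (r n))"
    by (rule folner_subseq[OF B r(1)])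
  obtain \<psi> where \<psi>: "limit_mean \<theta> (\<lambda>n. B (r n)) \<psi>"
    by (rule limit_mean_exists[of "\<lambda>n. B (r n)", OF folner_compact[OF C]])
  interpret \<psi>: folner_mean \<theta> "\<lambda>n. B (r n)" \<psi>
    by unfold_locales (fact C \<psi>)+
  have bc: "f \<in> bounded_cont" "g \<in> bounded_cont"
    using f g Cu_subset_bounded_cont by (auto simp: in_closure_of topspace_Cu_weak)
  have "\<psi> f = a"
    using LIMSEQ_subseq_LIMSEQ[OF lim r(1)] by (intro \<psi>.mean_eq_limit bc) (simp add: o_def)
  then have "\<psi> (translate_fun t f) \<in> {a}" for t
    by (simp add: \<psi>.mean_translate[OF bc(1)])
  then have "\<psi> g \<in> {a}"
    by (rule orbit_closure_dual[OF g \<psi>.mean_dual closed_singleton])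
  moreover have "\<psi> g \<in> - ball a e"
    by (rule \<psi>.mean_closed[OF bc(2)]) (use r(2) in \<open>auto simp: dist_commute\<close>)
  ultimately show False using e by simp
qed

lemma has_mean_iff_avg:
  "has_mean \<theta> f m \<longleftrightarrow> (\<forall>A. folner \<theta> A \<longrightarrow>
     uniform_limit UNIV (\<lambda>n x. avg \<theta> ((+) x ` A n) f) (\<lambda>_. m) sequentially)"
proof -
  have "(\<lambda>n x. (LINT t:((+) x ` A n)|\<theta>. f t) / complex_of_real (measure \<theta> (A n)))
      = (\<lambda>n x. avg \<theta> ((+) x ` A n) f)" if "folner \<theta> A" for A
  proof -
    have "measure \<theta> ((+) x ` A n) = measure \<theta> (A n)" for x n
      using compact_sets[OF folner_compact[OF that]] by (intro measure_translate) simp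
    then show ?thesis by (simp add: avg_def)
  qed
  then show ?thesis
    unfolding has_mean_def by auto
qed

end

context folner_mean
begin

text \<open>On the weak orbit closure, which is compact, the averages along \<open>B\<close> form a bounded sequence of
  continuous functions converging pointwise to \<open>a\<close>; bounded convergence lets the invariant mean
  \<open>\<phi>\<close>, under which all these averages have the value \<open>\<phi> f\<close>, pass to the limit.\<close>

lemma mean_unique:
  assumes f: "f \<in> Cu" and K: "compactin Cu_weak K" and fK: "\<And>t. translate_fun t f \<in> K"
    and B: "folner \<theta> B" and lim: "(\<lambda>n. avg \<theta> (B n) f) \<longlonglongrightarrow> a"
  shows "\<phi> f = a"
proof (rule ccontr)
  assume "\<phi> f \<noteq> a"
  define e where "e = norm (\<phi> f - a)"
  have e: "e > 0"
    using \<open>\<phi> f \<noteq> a\<close> by (simp add: e_def)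
  \<comment> \<open>Compactness is inherited from \<open>K\<close>, convergence of the averages from
    the orbit closure; both are wanted on one space.\<close>
  let ?K = "orbit_closure f \<inter> K"
  let ?X = "subtopology Cu_weak ?K"
  define \<tau> where "\<tau> s = translate_fun (- s) f" for s
  define h where "h n g = norm (avg \<theta> (B n) g - a)" for n g
  \<comment> \<open>The image of the mean \<phi> under the orbit map \<tau>: a positive functional
    on a compact space, which is where bounded convergence holds.\<close>
  define p where "p u = Re (\<phi> (\<lambda>s. complex_of_real (u (\<tau> s))))" for u :: "('a \<Rightarrow> complex) \<Rightarrow> real"
  note bc = subsetD[OF Cu_subset_bounded_cont]
  have Kc: "compactin Cu_weak ?K"
    by (rule closed_Int_compactin[OF closedin_closure_of K])
  then have X: "compact_space ?X"
    by (rule compact_space_subtopology)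
  have topX: "topspace ?X = ?K"
    using compactin_subset_topspace[OF Kc] by (simp add: Int_absorb1)
  have \<tau>_cont: "continuous_map euclidean ?X \<tau>"
    unfolding \<tau>_def
  proof (rule continuous_map_into_subtopology[OF continuous_map_orbit[OF f]])
    show "(\<lambda>s. translate_fun (- s) f) \<in> topspace euclidean \<rightarrow> ?K"
      using fK orbit_closure_contains[OF f] by simp
  qed
  have u\<tau>: "continuous_on UNIV (\<lambda>s. u (\<tau> s))" "bounded (range (\<lambda>s. u (\<tau> s)))"
    if "continuous_map ?X euclideanreal u" for u
  proof -
    have "continuous_map euclidean euclideanreal (u \<circ> \<tau>)"
      by (rule continuous_map_compose[OF \<tau>_cont that])
    then show "continuous_on UNIV (\<lambda>s. u (\<tau> s))"
      by (simp add: o_def)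
    have "compactin ?X ?K"
      using X topX by (simp add: compact_space_def)
    then have "compact (u ` ?K)"
      using image_compactin[OF _ that] by fastforce
    moreover have "range (\<lambda>s. u (\<tau> s)) \<subseteq> u ` ?K"
      using continuous_map_image_subset_topspace[OF \<tau>_cont] unfolding topX image_subset_iff
      by (simp add: image_subset_iff)
    ultimately show "bounded (range (\<lambda>s. u (\<tau> s)))"
      using bounded_subset compact_imp_bounded by blast
  qed
  have h_cont: "continuous_map ?X euclideanreal (h n)" for n
  proof -
    have "continuous_map ?X euclidean (avg \<theta> (B n))"
      by (intro continuous_map_from_subtopology continuous_map_Cu_dual avg_dual folner_compact[OF B])
    moreover have "continuous_map euclidean euclideanreal (\<lambda>z::complex. norm (z - a))"
      by (simp add: continuous_intros)
    ultimately have "continuous_map ?X euclideanreal ((\<lambda>z. norm (z - a)) \<circ> avg \<theta> (B n))"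
      by (rule continuous_map_compose)
    moreover have "(\<lambda>z. norm (z - a)) \<circ> avg \<theta> (B n) = h n"
      by (simp add: fun_eq_iff h_def)
    ultimately show ?thesis by simp
  qed
  have "\<exists>n. p (h n) < e"
  proof (rule bounded_convergence_functional[OF X _ _ _ h_cont _ _ e])
    fix u v :: "('a \<Rightarrow> complex) \<Rightarrow> real"
    assume uv: "continuous_map ?X euclideanreal u" "continuous_map ?X euclideanreal v"
    show "p (\<lambda>x. u x + v x) = p u + p v"
      using mean_add[OF bounded_cont_of_real[OF u\<tau>[OF uv(1)]] bounded_cont_of_real[OF u\<tau>[OF uv(2)]]]
      by (simp add: p_def)
    show "p u \<le> p v" if "\<And>x. x \<in> topspace ?X \<Longrightarrow> u x \<le> v x"
      unfolding p_def
    proof (rule mean_mono[OF u\<tau>[OF uv(1)] u\<tau>[OF uv(2)]])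
      show "u (\<tau> s) \<le> v (\<tau> s)" for s
        using continuous_map_image_subset_topspace[OF \<tau>_cont] by (intro that) auto
    qed
  next
    show "p (\<lambda>_. c) \<le> c" for c
      by (simp add: p_def mean_const)
  next
    fix n g assume "g \<in> topspace ?X"
    then have g: "g \<in> orbit_closure f" "g \<in> Cu"
      using topX compactin_Cu_weak_subset[OF Kc] by auto
    have "norm (avg \<theta> (B n) g) \<le> sup_norm f"
      using orbit_closure_bound[OF g(1) norm_le_sup_norm[OF Cu_bounded[OF f]]]
      by (intro norm_avg_bound bc g folner_compact[OF B])
    then show "h n g \<le> sup_norm f + norm a"
      unfolding h_def using norm_triangle_ineq4[of "avg \<theta> (B n) g" a] by linarith
  next
    fix g assume "g \<in> topspace ?X"
    then have "(\<lambda>n. avg \<theta> (B n) g) \<longlonglongrightarrow> a"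
      using topX by (intro avg_orbit_closure[OF f B lim]) auto
    then have "(\<lambda>n. norm (avg \<theta> (B n) g - a)) \<longlonglongrightarrow> norm (a - a)"
      by (intro tendsto_norm tendsto_diff tendsto_const)
    then show "(\<lambda>n. h n g) \<longlonglongrightarrow> 0"
      by (simp add: h_def)
  qed
  then obtain n where n: "p (h n) < e" ..
  \<comment> \<open>Up to notation \<open>norm (?v s)\<close> is \<open>h n (\<tau> s)\<close>, so
    \<open>p (h n)\<close> bounds the norm of \<open>\<phi> ?v\<close>. By \<open>mean_avg\<close>
    the latter equals \<open>e\<close> for every \<open>n\<close>, against the choice of
    \<open>n\<close>.\<close>
  let ?v = "\<lambda>s. avg \<theta> (B n) (\<lambda>t. f (s + t)) + (- a)"
  have g: "(\<lambda>s. avg \<theta> (B n) (\<lambda>t. f (s + t))) \<in> Cu"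
    by (rule Cu_avg[OF f folner_compact[OF B]])
  have v: "?v \<in> bounded_cont"
    by (intro bc Cu_add g Cu_const)
  have "\<phi> ?v = \<phi> f - a"
    using mean_add[OF bc[OF g] bc[OF Cu_const[of "- a"]]] mean_avg[OF f folner_compact[OF B] folner_pos[OF B]]
    by (simp add: mean_const)
  then have "e = norm (\<phi> ?v)"
    by (simp add: e_def)
  also have "\<dots> \<le> Re (\<phi> (\<lambda>s. complex_of_real (norm (?v s))))"
    by (rule norm_mean_le[OF v])
  also have "(\<lambda>s. complex_of_real (norm (?v s))) = (\<lambda>s. complex_of_real (h n (\<tau> s)))"
    by (simp add: h_def \<tau>_def translate_fun_def add.commute)
  also have "Re (\<phi> \<dots>) = p (h n)"
    by (simp add: p_def)
  finally show False using n by simp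
qed

text \<open>A failure of uniform convergence picks shifts \<open>x n\<close> whose averages stay
  away from \<open>\<phi> f\<close>. The shifted sets form a Folner sequence, the averages are
  bounded, and the limit of a convergent subsequence is \<open>\<phi> f\<close> by
  \<open>mean_unique\<close>.\<close>

lemma has_mean:
  assumes f: "f \<in> Cu" and K: "compactin Cu_weak K" and fK: "\<And>t. translate_fun t f \<in> K"
  shows "has_mean \<theta> f (\<phi> f)"
  unfolding has_mean_iff_avg
proof (intro allI impI uniform_limitI, rule ccontr)
  fix B :: "nat \<Rightarrow> 'a set" and e :: real assume B: "folner \<theta> B" and e: "e > 0"
  note bc = subsetD[OF Cu_subset_bounded_cont]
  assume ne: "\<not> (\<forall>\<^sub>F n in sequentially. \<forall>x\<in>UNIV. dist (avg \<theta> ((+) x ` B n) f) (\<phi> f) < e)"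
  from not_eventually_sequentiallyD[OF ne]
  obtain r :: "nat \<Rightarrow> nat" where r: "strict_mono r"
      "\<forall>n. \<not> (\<forall>x\<in>UNIV. dist (avg \<theta> ((+) x ` B (r n)) f) (\<phi> f) < e)"
    by (elim exE conjE)
  then obtain x where x: "\<And>n. e \<le> dist (avg \<theta> ((+) (x n) ` B (r n)) f) (\<phi> f)"
    by (metis UNIV_I not_less)
  let ?C = "\<lambda>n. (+) (x n) ` B (r n)"
  have C: "folner \<theta> ?C"
    by (rule folner_translate[OF folner_subseq[OF B r(1)]])
  have "norm (avg \<theta> (?C n) f) \<le> sup_norm f" for n
    by (intro norm_avg_bound bc f folner_compact[OF C] norm_le_sup_norm Cu_bounded)
  then have "bounded (range (\<lambda>n. avg \<theta> (?C n) f))"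
    unfolding bounded_range_iff by blast
  then obtain a r' where r': "strict_mono r'" "((\<lambda>n. avg \<theta> (?C n) f) \<circ> r') \<longlonglongrightarrow> a"
    using bounded_imp_convergent_subsequence by blast
  have lim: "(\<lambda>n. avg \<theta> (?C (r' n)) f) \<longlonglongrightarrow> a"
    using r'(2) by (simp add: o_def)
  have "\<phi> f = a"
    by (rule mean_unique[OF f K fK folner_subseq[OF C r'(1)] lim])
  then have "\<forall>\<^sub>F n in sequentially. dist (avg \<theta> (?C (r' n)) f) (\<phi> f) < e"
    using tendstoD[OF lim e] by simp
  then show False
    using x by (auto simp: eventually_sequentially not_less[symmetric])
qed

end

context haar
begin

lemma mean_fun_eq:
  assumes "folner \<theta> A" "has_mean \<theta> f m"
  shows "mean_fun \<theta> f = m"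
proof -
  have "m1 = m2" if "has_mean \<theta> f m1" "has_mean \<theta> f m2" for m1 m2
  proof -
    have "(\<lambda>n. avg \<theta> ((+) 0 ` A n) f) \<longlonglongrightarrow> m" if "has_mean \<theta> f m" for m
    proof -
      have "uniform_limit UNIV (\<lambda>n x. avg \<theta> ((+) x ` A n) f) (\<lambda>_. m) sequentially"
        using that assms(1) by (simp add: has_mean_iff_avg)
      then show ?thesis
        by (rule tendsto_uniform_limitI) simp
    qed
    from LIMSEQ_unique[OF this[OF that(1)] this[OF that(2)]] show ?thesis .
  qed
  then show ?thesis
    unfolding mean_fun_def using assms(2) by (intro the_equality) auto
qed

text \<open>Averaging the shifted function over x + B n is averaging \<open>f\<close> over (x - t) +
  B n, so uniformity over all translates absorbs the shift.\<close>

lemma has_mean_scale_translate: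
  assumes f: "f \<in> bounded_cont" and m: "has_mean \<theta> f m"
  shows "has_mean \<theta> (\<lambda>x. k * f (x - t)) (k * m)"
  unfolding has_mean_iff_avg
proof (intro allI impI uniform_limitI)
  fix B :: "nat \<Rightarrow> 'a set" and e :: real assume B: "folner \<theta> B" and e: "e > 0"
  have "uniform_limit UNIV (\<lambda>n x. avg \<theta> ((+) x ` B n) f) (\<lambda>_. m) sequentially"
    using m B by (simp add: has_mean_iff_avg)
  \<comment> \<open>The summand 1 covers k = 0.\<close>
  moreover have "e / (norm k + 1) > 0"
    using e by (simp add: add_nonneg_pos)
  ultimately have "\<forall>\<^sub>F n in sequentially. \<forall>x\<in>UNIV. dist (avg \<theta> ((+) x ` B n) f) m < e / (norm k + 1)"
    by (rule uniform_limitD)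
  then show "\<forall>\<^sub>F n in sequentially. \<forall>x\<in>UNIV. dist (avg \<theta> ((+) x ` B n) (\<lambda>x. k * f (x - t))) (k * m) < e"
  proof (rule eventually_mono, intro ballI)
    fix n x assume *: "\<forall>x\<in>UNIV. dist (avg \<theta> ((+) x ` B n) f) m < e / (norm k + 1)"
    have f': "(\<lambda>x. f (x - t)) \<in> bounded_cont"
      using bounded_cont_comp[OF f continuous_on_id, of "- t"] by (simp add: algebra_simps)
    have "compact (B n)"
      by (rule folner_compact[OF B])
    then have "avg \<theta> ((+) x ` B n) (\<lambda>x. f (x - t)) = avg \<theta> ((+) (x - t) ` B n) f"
      unfolding avg_translate[OF f \<open>compact (B n)\<close>] avg_translate[OF f' \<open>compact (B n)\<close>]
      by (simp add: algebra_simps)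
    then have "dist (avg \<theta> ((+) x ` B n) (\<lambda>x. k * f (x - t))) (k * m)
        = norm k * dist (avg \<theta> ((+) (x - t) ` B n) f) m"
      by (simp add: avg_scale dist_norm norm_mult[symmetric] right_diff_distrib)
    also have "\<dots> \<le> norm k * (e / (norm k + 1))"
      using * by (intro mult_left_mono) (auto intro: less_imp_le)
    also have "\<dots> < e"
    proof -
      have "norm k * e < e * (norm k + 1)"
        using e by (simp add: algebra_simps)
      then show ?thesis
        by (simp add: pos_divide_less_eq add_nonneg_pos)
    qed
    finally show "dist (avg \<theta> ((+) x ` B n) (\<lambda>x. k * f (x - t))) (k * m) < e" .
  qed
qed

end

section \<open>Uniqueness of the invariant functional\<close>

text \<open>A translation invariant complex Radon measure in the sense of
  \<open>radon_measures\<close>, but without extensionality, so that \<lambda>-expressions such as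
  the Haar integral qualify as they stand.\<close>

definition invariant_functional :: "(('a::topological_ab_group_add \<Rightarrow> complex) \<Rightarrow> complex) \<Rightarrow> bool" where
  "invariant_functional J \<longleftrightarrow>
     (\<forall>f\<in>Cc. \<forall>g\<in>Cc. J (\<lambda>x. f x + g x) = J f + J g) \<and>
     (\<forall>a. \<forall>f\<in>Cc. J (\<lambda>x. a * f x) = a * J f) \<and>
     (\<forall>K. compact K \<longrightarrow> (\<exists>B. \<forall>f\<in>Cc. supp f \<subseteq> K \<longrightarrow> norm (J f) \<le> B * sup_norm f)) \<and>
     (\<forall>t. \<forall>f\<in>Cc. J (\<lambda>x. f (x + t)) = J f)"

lemma invariant_functional_add:
  "invariant_functional J \<Longrightarrow> f \<in> Cc \<Longrightarrow> g \<in> Cc \<Longrightarrow> J (\<lambda>x. f x + g x) = J f + J g"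
  by (simp add: invariant_functional_def)

lemma invariant_functional_scale:
  "invariant_functional J \<Longrightarrow> f \<in> Cc \<Longrightarrow> J (\<lambda>x. a * f x) = a * J f"
  by (simp add: invariant_functional_def)

lemma invariant_functional_shift:
  "invariant_functional J \<Longrightarrow> f \<in> Cc \<Longrightarrow> J (\<lambda>x. f (x + t)) = J f"
  by (simp add: invariant_functional_def)

lemma invariant_functional_bound:
  "invariant_functional J \<Longrightarrow> compact K \<Longrightarrow> \<exists>B. \<forall>f\<in>Cc. supp f \<subseteq> K \<longrightarrow> norm (J f) \<le> B * sup_norm f"
  by (simp add: invariant_functional_def)

lemma Cc_bounded_cont:
  fixes f :: "'a::topological_ab_group_add \<Rightarrow> complex"
  shows "f \<in> Cc \<Longrightarrow> f \<in> bounded_cont"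
  by (rule subsetD[OF Cu_subset_bounded_cont Cc_Cu])

lemma Cc_bounded:
  fixes f :: "'a::topological_ab_group_add \<Rightarrow> complex"
  shows "f \<in> Cc \<Longrightarrow> bounded (range f)"
  by (rule Cu_bounded[OF Cc_Cu])

lemma invariant_functional_sum:
  fixes J :: "('a::{topological_ab_group_add, t2_space} \<Rightarrow> complex) \<Rightarrow> complex"
  assumes J: "invariant_functional J" and f: "\<And>i. i \<in> I \<Longrightarrow> f i \<in> Cc"
  shows "J (\<lambda>x. \<Sum>i\<in>I. f i x) = (\<Sum>i\<in>I. J (f i))"
proof -
  have zero: "J (\<lambda>_. 0) = 0"
    using invariant_functional_scale[OF J Cc_zero, of 0] by simp
  show ?thesis
    using f
  proof (induction I rule: infinite_finite_induct)
    case (insert i I)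
    have "J (\<lambda>x. f i x + (\<Sum>i\<in>I. f i x)) = J (f i) + J (\<lambda>x. \<Sum>i\<in>I. f i x)"
      by (intro invariant_functional_add[OF J] Cc_sum insert.prems) auto
    with insert show ?case by simp
  qed (simp_all add: zero)
qed

context haar
begin

lemma Cc_set_integrable: "f \<in> Cc \<Longrightarrow> compact A \<Longrightarrow> set_integrable \<theta> A f"
  by (rule set_integrable_compact[OF Cc_bounded_cont])

lemma set_integral_eq_integral:
  fixes f :: "'a \<Rightarrow> complex"
  assumes "\<And>x. f x \<noteq> 0 \<Longrightarrow> x \<in> A"
  shows "(LINT t:A|\<theta>. f t) = (LINT t|\<theta>. f t)"
  unfolding set_lebesgue_integral_def
  by (rule Bochner_Integration.integral_cong) (use assms in \<open>auto simp: indicator_def\<close>)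

lemma Cc_integrable:
  assumes "f \<in> Cc" shows "integrable \<theta> f"
proof -
  have "integrable \<theta> (\<lambda>t. indicator (supp f) t *\<^sub>R f t)"
    using Cc_set_integrable[OF assms Cc_compact_supp[OF assms]] by (simp add: set_integrable_def)
  moreover have "(\<lambda>t. indicator (supp f) t *\<^sub>R f t) = f"
    using supp_nonzero[of f] by (auto simp: indicator_def fun_eq_iff)
  ultimately show ?thesis by simp
qed

lemma invariant_functional_haar: "invariant_functional (\<lambda>f. LINT t|\<theta>. f t)"
  unfolding invariant_functional_def
proof (intro conjI ballI allI impI)
  show "(LINT t|\<theta>. f t + g t) = (LINT t|\<theta>. f t) + (LINT t|\<theta>. g t)" if "f \<in> Cc" "g \<in> Cc" for f g
    using that by (intro Bochner_Integration.integral_add Cc_integrable)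
  show "(LINT t|\<theta>. a * f t) = a * (LINT t|\<theta>. f t)" for f and a :: complex
    by (rule integral_mult_right_zero)
  show "(LINT x|\<theta>. f (x + t)) = (LINT t|\<theta>. f t)" if "f \<in> Cc" for f t
    using integral_translate[OF measurable_continuous[OF Cc_continuous[OF that]], of t]
    by (simp add: add.commute)
  fix K :: "'a set" assume K: "compact K"
  have "norm (LINT t|\<theta>. f t) \<le> measure \<theta> K * sup_norm f" if f: "f \<in> Cc" "supp f \<subseteq> K" for f
  proof -
    have "(LINT t:K|\<theta>. f t) = (LINT t|\<theta>. f t)"
      using supp_nonzero[of f] f(2) by (intro set_integral_eq_integral) auto
    then have "norm (LINT t|\<theta>. f t) = norm (complex_of_real (measure \<theta> K) * avg \<theta> K f)"
    proof (cases "measure \<theta> K = 0")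
      \<comment> \<open>Here the average is 0 only by the convention for division; the integral
        vanishes because \<open>K\<close> is a null set.\<close>
      case True
      then have "K \<in> null_sets \<theta>"
        using compact_sets[OF K] emeasure_compact[OF K]
        by (auto simp: null_sets_def measure_def enn2real_eq_0_iff)
      then have "(LINT t:K|\<theta>. f t) = 0"
        unfolding set_lebesgue_integral_def
        by (intro integral_eq_zero_AE) (auto dest: AE_not_in)
      then show ?thesis
        using \<open>(LINT t:K|\<theta>. f t) = (LINT t|\<theta>. f t)\<close> True by simp
    qed (simp add: avg_def)
    also have "\<dots> \<le> measure \<theta> K * sup_norm f"
      unfolding norm_mult using f K
      by (auto intro!: mult_left_mono norm_avg_bound Cc_bounded_cont norm_le_sup_norm Cc_bounded)
    finally show ?thesis .
  qed
  then show "\<exists>B. \<forall>f\<in>Cc. supp f \<subseteq> K \<longrightarrow> norm (LINT t|\<theta>. f t) \<le> B * sup_norm f"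
    by blast
qed

text \<open>Formally, exchange \<open>J\<close> with the integral and use invariance. The exchange
  is justified by Riemann sums \<open>r n\<close>, each a combination of translates of
  \<open>e\<close> with weights adding up to the integral of \<open>w\<close>, so that
  \<open>J (r n)\<close> is the claimed value for every \<open>n\<close>.\<close>

lemma functional_correlation:
  fixes e w :: "'a \<Rightarrow> complex" and \<tau> :: "'a \<Rightarrow> 'a"
  assumes J: "invariant_functional J" and e: "e \<in> Cc" and w: "w \<in> Cc" and \<tau>: "continuous_on UNIV \<tau>"
  shows "J (\<lambda>x. LINT t|\<theta>. e (x + \<tau> t) * w t) = J e * (LINT t|\<theta>. w t)"
proof -
  let ?E = "supp e" and ?S = "supp w"
  let ?h = "\<lambda>x. LINT t|\<theta>. e (x + \<tau> t) * w t"
  \<comment> \<open>The difference set of the two supports contains the supports of the correlation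
    and of all its Riemann sums. \<open>J\<close> is bounded only on functions with support in one
    compact set, so uniform convergence alone would not suffice.\<close>
  define Q where "Q = (\<lambda>p. fst p - \<tau> (snd p)) ` (?E \<times> ?S)"
  have Q: "compact Q"
    unfolding Q_def
    by (intro compact_continuous_image compact_Times Cc_compact_supp e w continuous_on_diff
        continuous_on_fst continuous_on_compose2[OF \<tau>] continuous_on_snd continuous_on_id) auto
  have inQ: "x \<in> Q" if "e (x + \<tau> t) \<noteq> 0" "t \<in> ?S" for x t
    unfolding Q_def using supp_nonzero[of e "x + \<tau> t"] that
    by (intro image_eqI[of _ _ "(x + \<tau> t, t)"]) auto
  have S: "compact ?S"
    by (rule Cc_compact_supp[OF w])
  note int_w = Cc_set_integrable[OF w S]
  define W where "W = (LINT t:?S|\<theta>. norm (w t))"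
  have W: "W \<ge> 0"
    unfolding W_def set_lebesgue_integral_def by (intro integral_nonneg_AE) auto
  have wS: "(LINT t:?S|\<theta>. w t) = (LINT t|\<theta>. w t)"
    by (rule set_integral_eq_integral) (rule supp_nonzero)
  have hS: "(LINT t:?S|\<theta>. e (x + \<tau> t) * w t) = ?h x" for x
    by (rule set_integral_eq_integral) (rule supp_nonzero, simp)
  have "\<exists>r\<in>Cc. J r = J e * (LINT t|\<theta>. w t) \<and> (\<forall>x. r x \<noteq> 0 \<longrightarrow> x \<in> Q) \<and>
      (\<forall>x. norm (?h x - r x) \<le> inverse (real (Suc n)) * W)" for n
  proof -
    have pos: "inverse (real (Suc n)) > 0" by simp
    obtain D v where D: "finite D" "D \<subseteq> ?S" "(\<Sum>t\<in>D. v t) = (LINT s:?S|\<theta>. w s)"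
      "\<And>x. norm ((LINT s:?S|\<theta>. e (x + \<tau> s) * w s) - (\<Sum>t\<in>D. e (x + \<tau> t) * v t))
        \<le> inverse (real (Suc n)) * (LINT s:?S|\<theta>. norm (w s))"
      using riemann_approx[OF Cc_Cu[OF e] \<tau> S int_w pos] by blast
    define r where "r x = (\<Sum>t\<in>D. v t * e (x + \<tau> t))" for x
    have Cc: "(\<lambda>x. v t * e (x + \<tau> t)) \<in> Cc" for t
      by (intro Cc_scale Cc_shift e)
    have "J (\<lambda>x. v t * e (x + \<tau> t)) = v t * J e" for t
    proof -
      have "J (\<lambda>x. v t * e (x + \<tau> t)) = v t * J (\<lambda>x. e (x + \<tau> t))"
        by (rule invariant_functional_scale[OF J Cc_shift[OF e]])
      also have "J (\<lambda>x. e (x + \<tau> t)) = J e"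
        by (rule invariant_functional_shift[OF J e])
      finally show ?thesis .
    qed
    then have "J r = (\<Sum>t\<in>D. v t) * J e"
      unfolding r_def using invariant_functional_sum[OF J, of D "\<lambda>t x. v t * e (x + \<tau> t)"] Cc
      by (simp add: sum_distrib_right)
    then have "J r = J e * (LINT t|\<theta>. w t)"
      by (simp add: D(3) wS)
    moreover have "r \<in> Cc"
      unfolding r_def using Cc by (intro Cc_sum)
    moreover have "x \<in> Q" if "r x \<noteq> 0" for x
    proof -
      obtain t where "t \<in> D" "v t * e (x + \<tau> t) \<noteq> 0"
        using \<open>r x \<noteq> 0\<close> unfolding r_def by (rule sum.not_neutral_contains_not_neutral)
      then show ?thesis
        using D(2) by (intro inQ[of x t]) auto
    qed
    moreover have "norm (?h x - r x) \<le> inverse (real (Suc n)) * W" for x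
    proof -
      have "r x = (\<Sum>t\<in>D. e (x + \<tau> t) * v t)"
        by (simp add: r_def mult.commute)
      then show ?thesis
        using D(4)[of x] by (simp only: hS W_def)
    qed
    ultimately show ?thesis by blast
  qed
  then have "\<exists>r. \<forall>n. r n \<in> Cc \<and> J (r n) = J e * (LINT t|\<theta>. w t) \<and> (\<forall>x. r n x \<noteq> 0 \<longrightarrow> x \<in> Q) \<and>
      (\<forall>x. norm (?h x - r n x) \<le> inverse (real (Suc n)) * W)"
    by (intro choice allI) (simp only: Bex_def)
  then obtain r where r: "\<And>n. r n \<in> Cc" "\<And>n. J (r n) = J e * (LINT t|\<theta>. w t)"
      "\<And>n x. r n x \<noteq> 0 \<Longrightarrow> x \<in> Q" "\<And>n x. norm (?h x - r n x) \<le> inverse (real (Suc n)) * W"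
    by blast
  have limW: "(\<lambda>n. inverse (real (Suc n)) * C) \<longlonglongrightarrow> 0" for C
    using tendsto_mult_right[OF LIMSEQ_inverse_real_of_nat, of C] by simp
  have "uniform_limit UNIV r ?h sequentially"
  proof (rule uniform_limitI)
    fix \<epsilon> :: real assume "\<epsilon> > 0"
    with limW have "\<forall>\<^sub>F n in sequentially. inverse (real (Suc n)) * W < \<epsilon>"
      by (rule order_tendstoD)
    then show "\<forall>\<^sub>F n in sequentially. \<forall>x\<in>UNIV. dist (r n x) (?h x) < \<epsilon>"
    proof (rule eventually_mono, intro ballI)
      fix n x assume "inverse (real (Suc n)) * W < \<epsilon>"
      then show "dist (r n x) (?h x) < \<epsilon>"
        using r(4)[of x n] by (simp only: dist_norm norm_minus_commute)
    qed
  qed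
  then have h_cont: "continuous_on UNIV ?h"
    by (rule uniform_limit_theorem[rotated]) (simp_all add: Cc_continuous r(1))
  have h_supp: "x \<in> Q" if "?h x \<noteq> 0" for x
  proof (rule ccontr)
    assume "x \<notin> Q"
    then have "e (x + \<tau> t) * w t = 0" for t
      using inQ[of x t] supp_nonzero[of w t] by auto
    with that show False by simp
  qed
  have h: "?h \<in> Cc"
    by (rule CcI[OF h_cont Q h_supp])
  obtain B where B: "\<forall>f\<in>Cc. supp f \<subseteq> Q \<longrightarrow> norm (J f) \<le> B * sup_norm f"
    using invariant_functional_bound[OF J Q] ..
  have "norm (J ?h - J e * (LINT t|\<theta>. w t)) \<le> inverse (real (Suc n)) * (W * \<bar>B\<bar>)" for n
  proof -
    let ?d = "\<lambda>x. ?h x + (- 1) * r n x"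
    have d: "?d \<in> Cc"
      by (intro Cc_add Cc_scale h r(1))
    have "J ?d = J ?h + J (\<lambda>x. (- 1) * r n x)"
      by (rule invariant_functional_add[OF J h Cc_scale[OF r(1)]])
    also have "J (\<lambda>x. (- 1) * r n x) = (- 1) * J (r n)"
      by (rule invariant_functional_scale[OF J r(1)])
    finally have "norm (J ?h - J e * (LINT t|\<theta>. w t)) = norm (J ?d)"
      by (simp add: r(2))
    also have "\<dots> \<le> B * sup_norm ?d"
    proof (rule B[rule_format, OF d supp_subset[OF Q]])
      show "x \<in> Q" if "?d x \<noteq> 0" for x
        using that h_supp[of x] r(3)[of n x] by (cases "r n x = 0") auto
    qed
    also have "\<dots> \<le> \<bar>B\<bar> * (inverse (real (Suc n)) * W)"
    proof (rule mult_mono)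
      show "sup_norm ?d \<le> inverse (real (Suc n)) * W"
        by (rule sup_norm_least) (use r(4) in simp)
      show "0 \<le> sup_norm ?d"
        by (rule sup_norm_nonneg[OF Cc_bounded[OF d]])
    qed simp_all
    finally show ?thesis by (simp only: mult_ac)
  qed
  then have "norm (J ?h - J e * (LINT t|\<theta>. w t)) \<le> 0"
    by (intro LIMSEQ_le_const[OF limW]) blast
  then show ?thesis by simp
qed

text \<open>Both sides are values of \<open>J\<close> on one and the same correlation of \<open>c\<close> and \<open>d\<close>. Applied to the Haar
  integral itself, the identity shows that the latter is invariant under inversion.\<close>

lemma functional_reflect:
  assumes J: "invariant_functional J" and c: "c \<in> Cc" and d: "d \<in> Cc"
  shows "J c * (LINT t|\<theta>. d t) = J (\<lambda>x. d (- x)) * (LINT t|\<theta>. c t)"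
proof -
  have d': "(\<lambda>x. d (- x)) \<in> Cc"
    using Cc_reflect[OF d, of 0] by simp
  \<comment> \<open>The substitution of t - x for t.\<close>
  have "(LINT t|\<theta>. c (x + t) * d t) = (LINT t|\<theta>. d (- (x + - t)) * c t)" for x
  proof -
    have "continuous_on UNIV (\<lambda>t. d (t - x))"
      using Cc_continuous[OF Cc_shift[OF d, of "- x"]] by simp
    then have "(\<lambda>t. c t * d (t - x)) \<in> borel_measurable \<theta>"
      by (intro measurable_continuous continuous_on_mult Cc_continuous[OF c])
    from integral_translate[OF this, of x] show ?thesis
      by (simp add: mult.commute)
  qed
  then show ?thesis
    using functional_correlation[OF J c d continuous_on_id]
      functional_correlation[OF J d' c continuous_on_minus[OF continuous_on_id]]
    by simp
qed

lemma invariant_functional_unique: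
  assumes J: "invariant_functional J" and c: "c \<in> Cc" and d: "d \<in> Cc"
    and c0: "c0 \<in> Cc" "(LINT t|\<theta>. c0 t) \<noteq> 0"
  shows "J c * (LINT t|\<theta>. d t) = J d * (LINT t|\<theta>. c t)"
proof -
  have d': "(\<lambda>x. d (- x)) \<in> Cc"
    using Cc_reflect[OF d, of 0] by simp
  \<comment> \<open>Obtained by cancelling the nonzero integral of \<open>c0\<close>.\<close>
  have "(LINT t|\<theta>. d t) = (LINT t|\<theta>. d (- t))"
    using functional_reflect[OF invariant_functional_haar c0(1) d] c0(2) by simp
  then show ?thesis
    using functional_reflect[OF J c d'] by simp
qed

text \<open>Local compactness enters the proof here: Urysohn's lemma gives a compactly supported
  function above the indicator of \<open>K\<close>, and a Folner set can serve as
  \<open>K\<close>.\<close>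

lemma exists_nonzero_integral:
  assumes lc: "locally_compact_space (euclidean :: 'a topology)"
    and K: "compact K" "measure \<theta> K > 0"
  obtains c where "c \<in> Cc" "(LINT t|\<theta>. c t) \<noteq> 0"
proof -
  have H: "Hausdorff_space (euclidean :: 'a topology)"
    unfolding Hausdorff_space_def disjnt_def by simp (metis hausdorff)
  obtain U L where UL: "open U" "compact L" "K \<subseteq> U" "U \<subseteq> L"
    using lc K(1) locally_compact_space_compact_closed_compact[OF disjI1[OF H]] by auto
  have "completely_regular_space (euclidean :: 'a topology)"
    using lc H by (intro locally_compact_regular_imp_completely_regular_space) auto
  then obtain f where f: "continuous_map euclidean (top_of_set {0..1::real}) f" "f ` (- U) \<subseteq> {0}" "f ` K \<subseteq> {1}"
    by (rule Urysohn_completely_regular_compact_closed[of 0 1 _ K "- U", rotated])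
      (use K UL in \<open>auto simp: disjnt_def\<close>)
  have f_cont: "continuous_on UNIV f" and f01: "\<And>x. f x \<in> {0..1}"
    using f(1) by (auto simp: continuous_map_in_subtopology)
  let ?c = "\<lambda>x. complex_of_real (f x)"
  have c: "?c \<in> Cc"
  proof (rule CcI[OF _ UL(2)])
    show "continuous_on UNIV ?c"
      by (intro continuous_on_of_real f_cont)
    show "x \<in> L" if "?c x \<noteq> 0" for x
      using that f(2) UL(4) by auto
  qed
  have int_f: "integrable \<theta> f"
    using integrable_Re[OF Cc_integrable[OF c]] by simp
  have "0 < (LINT t|\<theta>. indicator K t :: real)"
    using K compact_sets[OF K(1)] emeasure_compact[OF K(1)] by simp
  also have "\<dots> \<le> (LINT t|\<theta>. f t)"
  proof (rule integral_mono[OF integrable_real_indicator int_f])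
    show "indicator K x \<le> f x" for x
      using f(3) f01[of x] by (auto simp: indicator_def)
  qed (use compact_sets[OF K(1)] emeasure_compact[OF K(1)] in auto)
  finally have "(LINT t|\<theta>. ?c t) \<noteq> 0"
    by simp
  with c show thesis by (rule that)
qed

end

section \<open>The hull of a weakly almost periodic measure\<close>

lemma radon_add: "\<nu> \<in> radon_measures \<Longrightarrow> f \<in> Cc \<Longrightarrow> g \<in> Cc \<Longrightarrow> \<nu> (\<lambda>x. f x + g x) = \<nu> f + \<nu> g"
  by (simp add: radon_measures_def)

lemma radon_scale: "\<nu> \<in> radon_measures \<Longrightarrow> f \<in> Cc \<Longrightarrow> \<nu> (\<lambda>x. a * f x) = a * \<nu> f"
  by (simp add: radon_measures_def)

lemma topspace_vague: "topspace vague_topology = radon_measures"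
  by (auto simp: vague_topology_def radon_measures_def extensional_def)

lemma hull_subset_radon: "measure_hull \<mu> \<subseteq> radon_measures"
  unfolding measure_hull_def using closure_of_subset_topspace topspace_vague by metis

lemma continuous_map_vague:
  assumes "f \<in> Cc" shows "continuous_map vague_topology euclidean (\<lambda>\<nu>. \<nu> f)"
  unfolding vague_topology_def
  by (intro continuous_map_from_subtopology continuous_map_product_projection assms)

section \<open>Convolution of test functions with measures\<close>

lemma times_character_Cc:
  assumes "\<xi> \<in> dual_group" "c \<in> Cc" shows "(\<lambda>s. \<xi> s * c s) \<in> Cc"
  using Cc_times_character[OF cnj_character[OF assms(1)] assms(2)] by simp

lemma conv_add:
  fixes c d :: "'a::{topological_ab_group_add, t2_space} \<Rightarrow> complex"
  assumes "\<nu> \<in> radon_measures" "c \<in> Cc" "d \<in> Cc"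
  shows "conv (\<lambda>s. c s + d s) \<nu> x = conv c \<nu> x + conv d \<nu> x"
  unfolding conv_def by (intro radon_add Cc_reflect assms)

lemma conv_scale:
  fixes c :: "'a::{topological_ab_group_add, t2_space} \<Rightarrow> complex"
  assumes "\<nu> \<in> radon_measures" "c \<in> Cc"
  shows "conv (\<lambda>s. a * c s) \<nu> x = a * conv c \<nu> x"
  unfolding conv_def by (intro radon_scale Cc_reflect assms)

lemma conv_shift: "conv (\<lambda>s. c (s + t)) \<nu> x = conv c \<nu> (x + t)"
  by (simp add: conv_def algebra_simps)

lemma conv_translate_meas:
  fixes c :: "'a::{topological_ab_group_add, t2_space} \<Rightarrow> complex"
  assumes "c \<in> Cc"
  shows "conv c (translate_meas t \<nu>) = translate_fun t (conv c \<nu>)"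
  using Cc_reflect[OF assms] by (simp add: conv_def translate_meas_def translate_fun_def diff_diff_eq)

text \<open>Writing \<open>cnj (\<xi> s)\<close> as \<open>cnj (\<xi> x) * \<xi> (x - s)\<close>
  moves the twist from the measure to the test function, so that only convolutions with \<nu> itself
  remain to be controlled.\<close>

lemma conv_times_character:
  fixes c :: "'a::{topological_ab_group_add, t2_space} \<Rightarrow> complex"
  assumes \<xi>: "\<xi> \<in> dual_group" and \<nu>: "\<nu> \<in> radon_measures" and c: "c \<in> Cc"
  shows "conv c (times_meas (\<lambda>x. cnj (\<xi> x)) \<nu>) = (\<lambda>x. cnj (\<xi> x) * conv (\<lambda>s. \<xi> s * c s) \<nu> x)"
proof
  fix x
  have 1: "cnj (\<xi> x) * \<xi> x = 1"
    using norm_character[OF \<xi>, of x] complex_norm_square[of "\<xi> x"] by (simp add: mult.commute)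
  have 2: "cnj (\<xi> s) * c (x - s) = cnj (\<xi> x) * (\<xi> (x - s) * c (x - s))" for s
  proof -
    have "cnj (\<xi> x) * (\<xi> (x - s) * c (x - s)) = (cnj (\<xi> x) * \<xi> x) * (cnj (\<xi> s) * c (x - s))"
      by (simp add: character_diff[OF \<xi>] mult_ac)
    from this[unfolded 1 mult_1_left] show ?thesis by (rule sym)
  qed
  have "conv c (times_meas (\<lambda>x. cnj (\<xi> x)) \<nu>) x = \<nu> (\<lambda>s. cnj (\<xi> s) * c (x - s))"
    using Cc_reflect[OF c, of x] by (simp add: conv_def times_meas_def)
  also have "\<dots> = \<nu> (\<lambda>s. cnj (\<xi> x) * (\<xi> (x - s) * c (x - s)))"
    by (simp only: 2)
  also have "\<dots> = cnj (\<xi> x) * \<nu> (\<lambda>s. \<xi> (x - s) * c (x - s))"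
    using Cc_reflect[OF times_character_Cc[OF \<xi> c], of x] by (intro radon_scale[OF \<nu>])
  finally show "conv c (times_meas (\<lambda>x. cnj (\<xi> x)) \<nu>) x = cnj (\<xi> x) * conv (\<lambda>s. \<xi> s * c s) \<nu> x"
    by (simp add: conv_def)
qed

lemma WAP_conv:
  assumes "\<mu> \<in> WAP" "c \<in> Cc"
  shows "conv c \<mu> \<in> Cu" "compactin Cu_weak (orbit_closure (conv c \<mu>))"
  using assms by (simp_all add: WAP_def wap_fun_def)

lemma WAP_radon: "\<mu> \<in> WAP \<Longrightarrow> \<mu> \<in> radon_measures"
  by (simp add: WAP_def)

lemma continuous_map_conv_pointwise:
  fixes c :: "'a::{topological_ab_group_add, t2_space} \<Rightarrow> complex"
  assumes "c \<in> Cc" shows "continuous_map vague_topology pointwise (conv c)"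
  unfolding continuous_map_componentwise_UNIV conv_def
  by (intro allI continuous_map_vague Cc_reflect assms)

text \<open>The orbit closure of the convolution with \<mu> is weakly compact, hence closed
  pointwise, so its preimage under the vaguely continuous map \<open>conv c\<close> is closed. That
  preimage contains the translates of \<mu>.\<close>

lemma conv_hull:
  fixes \<mu> :: "('a::{topological_ab_group_add, t2_space} \<Rightarrow> complex) \<Rightarrow> complex"
  assumes \<mu>: "\<mu> \<in> WAP" and \<nu>: "\<nu> \<in> measure_hull \<mu>" and c: "c \<in> Cc"
  shows "conv c \<nu> \<in> orbit_closure (conv c \<mu>)"
proof -
  let ?K = "orbit_closure (conv c \<mu>)"
  let ?C = "{\<nu> \<in> topspace vague_topology. conv c \<nu> \<in> ?K}"
  have "closedin vague_topology ?C"
    by (rule closedin_continuous_map_preimage[OF continuous_map_conv_pointwise[OF c]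
          closedin_pointwise[OF WAP_conv(2)[OF \<mu> c]]])
  moreover have "topspace vague_topology \<inter> range (\<lambda>t. translate_meas t \<mu>) \<subseteq> ?C"
    using orbit_closure_contains[OF WAP_conv(1)[OF \<mu> c]] by (auto simp: conv_translate_meas[OF c])
  ultimately have "measure_hull \<mu> \<subseteq> ?C"
    unfolding measure_hull_def
    by (subst closure_of_restrict) (rule closure_of_minimal)
  with \<nu> show ?thesis by blast
qed

lemma continuous_map_conv_hull:
  fixes \<mu> :: "('a::{topological_ab_group_add, t2_space} \<Rightarrow> complex) \<Rightarrow> complex"
  assumes \<mu>: "\<mu> \<in> WAP" and c: "c \<in> Cc"
  shows "continuous_map (subtopology vague_topology (measure_hull \<mu>)) Cu_weak (conv c)"
proof (rule continuous_map_Cu_weak_pointwise[OF WAP_conv(2)[OF \<mu> c]])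
  show "conv c \<nu> \<in> orbit_closure (conv c \<mu>)"
    if "\<nu> \<in> topspace (subtopology vague_topology (measure_hull \<mu>))" for \<nu>
    using that by (intro conv_hull[OF \<mu> _ c]) simp
qed (intro continuous_map_from_subtopology continuous_map_conv_pointwise c)

section \<open>Bounds from translation boundedness\<close>

lemma norm_le_variation:
  fixes g :: "'a::t2_space \<Rightarrow> complex"
  assumes "g \<in> Cc" "supp g \<subseteq> A" "\<And>x. norm (g x) \<le> 1"
  shows "ennreal (norm (\<mu> g)) \<le> variation \<mu> A"
  unfolding variation_def
proof (rule INF_greatest)
  fix U assume "U \<in> {U. open U \<and> A \<subseteq> U}"
  with assms show "ennreal (norm (\<mu> g))
      \<le> (SUP g\<in>{g \<in> Cc. supp g \<subseteq> U \<and> (\<forall>x. norm (g x) \<le> 1)}. ennreal (norm (\<mu> g)))"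
    by (intro SUP_upper) auto
qed

text \<open>The function s |-> c (x - s) is supported in x - K, which explains
  \<open>uminus\<close>, and translation boundedness makes the constant independent of
  \<open>x\<close>. The bound later provides the Radon condition for c |-> \<phi> (c *
  \<kappa>).\<close>

lemma translation_bounded_conv:
  fixes \<mu> :: "('a::{topological_ab_group_add, t2_space} \<Rightarrow> complex) \<Rightarrow> complex"
  assumes \<mu>: "\<mu> \<in> WAP" and K: "compact K"
  obtains B where
    "\<And>c x. c \<in> Cc \<Longrightarrow> supp c \<subseteq> K \<Longrightarrow> norm (conv c \<mu> x) \<le> B * sup_norm c"
proof -
  let ?K = "uminus ` K"
  have "compact ?K"
    using K by (intro compact_continuous_image continuous_intros)
  then have fin: "(SUP x. variation \<mu> ((+) x ` ?K)) < \<infinity>"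
    using \<mu> by (simp add: WAP_def translation_bounded_def)
  define B where "B = enn2real (SUP x. variation \<mu> ((+) x ` ?K))"
  have "norm (conv c \<mu> x) \<le> B * sup_norm c" if c: "c \<in> Cc" and cK: "supp c \<subseteq> K" for c x
  proof (cases "sup_norm c = 0")
    case True
    then have "c = (\<lambda>_. 0)"
      using norm_le_sup_norm[OF Cc_bounded[OF c]] by (auto simp: fun_eq_iff)
    moreover have "\<mu> (\<lambda>_. 0) = 0"
      using radon_scale[OF WAP_radon[OF \<mu>] Cc_zero, of 0] by simp
    ultimately show ?thesis
      using True by (simp add: conv_def)
  next
    case False
    then have pos: "sup_norm c > 0"
      using sup_norm_nonneg[OF Cc_bounded[OF c]] by simp
    \<comment> \<open>Normalisation to sup norm 1, as \<open>variation\<close> tests only functions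
      bounded by 1.\<close>
    define k where "k = complex_of_real (inverse (sup_norm c))"
    let ?g = "\<lambda>s. k * c (x - s)"
    have g: "?g \<in> Cc"
      by (intro Cc_scale Cc_reflect c)
    have "ennreal (norm (\<mu> ?g)) \<le> variation \<mu> ((+) x ` ?K)"
    proof (rule norm_le_variation[OF g supp_subset])
      show "compact ((+) x ` ?K)"
        by (rule compact_continuous_image[OF _ \<open>compact ?K\<close>]) (intro continuous_intros)
      show "s \<in> (+) x ` ?K" if "?g s \<noteq> 0" for s
      proof -
        have "x - s \<in> K"
          using that supp_nonzero[of c "x - s"] cK by auto
        then have "- (x - s) \<in> ?K"
          by (rule imageI)
        then show ?thesis
          by (rule rev_image_eqI) simp
      qed
      show "norm (?g s) \<le> 1" for s
        using norm_le_sup_norm[OF Cc_bounded[OF c], of "x - s"] pos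
        by (simp add: k_def norm_mult norm_inverse) (simp add: field_simps)
    qed
    also have "\<dots> \<le> (SUP x. variation \<mu> ((+) x ` ?K))"
      by (rule SUP_upper) simp
    also have "\<dots> = ennreal B"
      unfolding B_def using fin by simp
    finally have "norm (\<mu> ?g) \<le> B"
      by (simp add: B_def)
    moreover have "\<mu> ?g = k * conv c \<mu> x"
      unfolding conv_def by (rule radon_scale[OF WAP_radon[OF \<mu>] Cc_reflect[OF c]])
    ultimately show ?thesis
      using pos by (simp add: k_def norm_mult norm_inverse) (simp add: field_simps)
  qed
  then show thesis
    by (rule that)
qed

section \<open>Fourier--Bohr coefficients\<close>

context folner_mean
begin

lemma mean_meas_eq:
  assumes "\<And>c. c \<in> Cc \<Longrightarrow> mean_fun \<theta> (conv c \<kappa>) = m * (LINT t|\<theta>. c t)"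
    and c0: "c0 \<in> Cc" "(LINT t|\<theta>. c0 t) \<noteq> 0"
  shows "mean_meas \<theta> \<kappa> = m"
  unfolding mean_meas_def
proof (rule the_equality)
  show "m' = m" if "\<forall>c\<in>Cc. mean_fun \<theta> (conv c \<kappa>) = m' * (LINT t|\<theta>. c t)" for m'
    using bspec[OF that c0(1)] assms(1)[OF c0(1)] c0(2) by simp
qed (use assms(1) in blast)

text \<open>By \<open>conv_times_character\<close> the function is a character times a member of a
  weakly compact orbit closure, and \<open>compactin_times_character\<close> supplies the weakly
  compact set that \<open>has_mean\<close> asks for.\<close>

lemma
  assumes \<mu>: "\<mu> \<in> WAP" and \<nu>: "\<nu> \<in> measure_hull \<mu>" and \<xi>: "\<xi> \<in> dual_group" and c: "c \<in> Cc"
  shows conv_character_Cu: "conv c (times_meas (\<lambda>x. cnj (\<xi> x)) \<nu>) \<in> Cu"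
    and has_mean_conv_character: "has_mean \<theta> (conv c (times_meas (\<lambda>x. cnj (\<xi> x)) \<nu>))
      (\<phi> (conv c (times_meas (\<lambda>x. cnj (\<xi> x)) \<nu>)))"
proof -
  let ?g = "conv (\<lambda>s. \<xi> s * c s) \<nu>"
  let ?K = "orbit_closure (conv (\<lambda>s. \<xi> s * c s) \<mu>)"
  have \<xi>c: "(\<lambda>s. \<xi> s * c s) \<in> Cc"
    by (rule times_character_Cc[OF \<xi> c])
  have K: "compactin Cu_weak ?K"
    by (rule WAP_conv(2)[OF \<mu> \<xi>c])
  have g: "?g \<in> ?K"
    by (rule conv_hull[OF \<mu> \<nu> \<xi>c])
  have eq: "conv c (times_meas (\<lambda>x. cnj (\<xi> x)) \<nu>) = (\<lambda>x. cnj (\<xi> x) * ?g x)"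
    by (rule conv_times_character[OF \<xi> subsetD[OF hull_subset_radon \<nu>] c])
  have Cu: "(\<lambda>x. cnj (\<xi> x) * ?g x) \<in> Cu"
    by (intro Cu_mult character_Cu cnj_character \<xi> subsetD[OF compactin_Cu_weak_subset[OF K] g])
  obtain L where L: "compactin Cu_weak L" "\<And>t. translate_fun t (\<lambda>x. cnj (\<xi> x) * ?g x) \<in> L"
    by (rule compactin_times_character[OF cnj_character[OF \<xi>] K translate_orbit_closure[OF g]])
      (rule that, assumption+)
  show "conv c (times_meas (\<lambda>x. cnj (\<xi> x)) \<nu>) \<in> Cu"
    unfolding eq by (rule Cu)
  show "has_mean \<theta> (conv c (times_meas (\<lambda>x. cnj (\<xi> x)) \<nu>)) (\<phi> (conv c (times_meas (\<lambda>x. cnj (\<xi> x)) \<nu>)))"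
    unfolding eq by (rule has_mean[OF Cu L])
qed

text \<open>Shifting \<open>c\<close> shifts the convolution, which \<phi> does not notice.
  Boundedness is known for \<mu> by translation boundedness and reaches \<nu> because pointwise
  bounds persist on orbit closures.\<close>

lemma invariant_functional_mean:
  assumes \<mu>: "\<mu> \<in> WAP" and \<nu>: "\<nu> \<in> measure_hull \<mu>" and \<xi>: "\<xi> \<in> dual_group"
  shows "invariant_functional (\<lambda>c. \<phi> (conv c (times_meas (\<lambda>x. cnj (\<xi> x)) \<nu>)))"
    (is "invariant_functional (\<lambda>c. \<phi> (conv c ?\<kappa>))")
  unfolding invariant_functional_def
proof (intro conjI ballI allI impI)
  note Cu = conv_character_Cu[OF \<mu> \<nu> \<xi>]
  note \<nu>' = subsetD[OF hull_subset_radon \<nu>]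
  note ct = conv_times_character[OF \<xi> \<nu>']
  note \<xi>c = times_character_Cc[OF \<xi>]
  show "\<phi> (conv (\<lambda>x. f x + g x) ?\<kappa>) = \<phi> (conv f ?\<kappa>) + \<phi> (conv g ?\<kappa>)" if "f \<in> Cc" "g \<in> Cc" for f g
  proof -
    have "conv (\<lambda>x. f x + g x) ?\<kappa> = (\<lambda>x. conv f ?\<kappa> x + conv g ?\<kappa> x)"
      using that
      by (simp add: ct Cc_add distrib_left conv_add[OF \<nu>' \<xi>c \<xi>c])
    then show ?thesis
      using Cu_dual_add[OF mean_dual Cu Cu, OF that] by simp
  qed
  show "\<phi> (conv (\<lambda>x. a * f x) ?\<kappa>) = a * \<phi> (conv f ?\<kappa>)" if "f \<in> Cc" for a f
  proof -
    have "conv (\<lambda>x. a * f x) ?\<kappa> = (\<lambda>x. a * conv f ?\<kappa> x)"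
      using that
      by (simp add: ct Cc_scale mult.left_commute[of _ a] conv_scale[OF \<nu>' \<xi>c])
    then show ?thesis
      using Cu_dual_scale[OF mean_dual Cu[OF that]] by simp
  qed
  show "\<phi> (conv (\<lambda>x. f (x + t)) ?\<kappa>) = \<phi> (conv f ?\<kappa>)" if "f \<in> Cc" for t f
  proof -
    have "conv (\<lambda>x. f (x + t)) ?\<kappa> = (\<lambda>x. conv f ?\<kappa> (t + x))"
      by (simp add: fun_eq_iff conv_shift add.commute)
    then show ?thesis
      using mean_shift[OF subsetD[OF Cu_subset_bounded_cont Cu[OF that]]] by simp
  qed
  fix K :: "'a set" assume K: "compact K"
  obtain B where B:
      "\<And>c x. c \<in> Cc \<Longrightarrow> supp c \<subseteq> K \<Longrightarrow> norm (conv c \<mu> x) \<le> B * sup_norm c"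
    by (rule translation_bounded_conv[OF \<mu> K]) (rule that, assumption+)
  have "norm (\<phi> (conv f ?\<kappa>)) \<le> B * sup_norm f" if f: "f \<in> Cc" "supp f \<subseteq> K" for f
  proof (rule mean_bound[OF subsetD[OF Cu_subset_bounded_cont Cu[OF f(1)]]])
    fix x
    have "supp (\<lambda>s. \<xi> s * f s) \<subseteq> K"
      using K f(2) supp_nonzero[of f] by (intro supp_subset) auto
    then have "norm (conv (\<lambda>s. \<xi> s * f s) \<mu> y) \<le> B * sup_norm (\<lambda>s. \<xi> s * f s)" for y
      by (rule B[OF \<xi>c[OF f(1)]])
    moreover have "sup_norm (\<lambda>s. \<xi> s * f s) = sup_norm f"
      by (simp add: sup_norm_def norm_mult norm_character[OF \<xi>])
    ultimately have "norm (conv (\<lambda>s. \<xi> s * f s) \<nu> x) \<le> B * sup_norm f"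
      by (intro orbit_closure_bound[OF conv_hull[OF \<mu> \<nu> \<xi>c[OF f(1)]]]) simp
    then show "norm (conv f ?\<kappa> x) \<le> B * sup_norm f"
      by (simp add: ct[OF f(1)] norm_mult norm_character[OF \<xi>])
  qed
  then show "\<exists>B. \<forall>f\<in>Cc. supp f \<subseteq> K \<longrightarrow> norm (\<phi> (conv f ?\<kappa>)) \<le> B * sup_norm f"
    by blast
qed

text \<open>Uniqueness of the invariant functional lets the single test function \<open>c0\<close>
  determine the coefficient, which gives a formula whose dependence on \<nu> is visible.\<close>

lemma
  assumes \<mu>: "\<mu> \<in> WAP" and \<nu>: "\<nu> \<in> measure_hull \<mu>" and \<xi>: "\<xi> \<in> dual_group"
    and c0: "c0 \<in> Cc" "(LINT t|\<theta>. c0 t) \<noteq> 0"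
  shows fourier_bohr_eq: "fourier_bohr \<theta> \<xi> \<nu>
      = \<phi> (\<lambda>x. cnj (\<xi> x) * conv (\<lambda>s. \<xi> s * c0 s) \<nu> x) / (LINT t|\<theta>. c0 t)"
    and fourier_bohr_translate: "fourier_bohr \<theta> \<xi> (translate_meas t \<nu>) = cnj (\<xi> t) * fourier_bohr \<theta> \<xi> \<nu>"
proof -
  let ?\<kappa> = "times_meas (\<lambda>x. cnj (\<xi> x)) \<nu>" and ?\<kappa>t = "times_meas (\<lambda>x. cnj (\<xi> x)) (translate_meas t \<nu>)"
  let ?m = "\<phi> (conv c0 ?\<kappa>) / (LINT t|\<theta>. c0 t)"
  have \<nu>': "\<nu> \<in> radon_measures"
    by (rule subsetD[OF hull_subset_radon \<nu>])
  have m: "\<phi> (conv c ?\<kappa>) = ?m * (LINT t|\<theta>. c t)" if "c \<in> Cc" for c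
    using invariant_functional_unique[OF invariant_functional_mean[OF \<mu> \<nu> \<xi>] that c0(1) c0] c0(2)
    by (simp add: field_simps)
  have fb: "fourier_bohr \<theta> \<xi> \<nu> = ?m"
    unfolding fourier_bohr_def
  proof (rule mean_meas_eq[OF _ c0])
    show "mean_fun \<theta> (conv c ?\<kappa>) = ?m * (LINT t|\<theta>. c t)" if "c \<in> Cc" for c
      using mean_fun_eq[OF folner has_mean_conv_character[OF \<mu> \<nu> \<xi> that]] m[OF that] by simp
  qed
  then show "fourier_bohr \<theta> \<xi> \<nu>
      = \<phi> (\<lambda>x. cnj (\<xi> x) * conv (\<lambda>s. \<xi> s * c0 s) \<nu> x) / (LINT t|\<theta>. c0 t)"
    by (simp add: conv_times_character[OF \<xi> \<nu>' c0(1)])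
  show "fourier_bohr \<theta> \<xi> (translate_meas t \<nu>) = cnj (\<xi> t) * fourier_bohr \<theta> \<xi> \<nu>"
    unfolding fb unfolding fourier_bohr_def
  proof (rule mean_meas_eq[OF _ c0])
    fix c :: "'a \<Rightarrow> complex" assume c: "c \<in> Cc"
    \<comment> \<open>The twist of the translate is a scaled translate of the twist, so its mean is
      read off from that of \<open>?\<kappa>\<close>.\<close>
    have "conv c ?\<kappa>t = (\<lambda>x. cnj (\<xi> t) * conv c (translate_meas t ?\<kappa>) x)"
      unfolding conv_def
      using times_cnj_character_translate_meas[OF \<xi> \<nu>' Cc_reflect[OF c]] by simp
    also have "\<dots> = (\<lambda>x. cnj (\<xi> t) * conv c ?\<kappa> (x - t))"
      by (simp add: conv_translate_meas[OF c] translate_fun_def)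
    finally have eq: "conv c ?\<kappa>t = (\<lambda>x. cnj (\<xi> t) * conv c ?\<kappa> (x - t))" .
    have "has_mean \<theta> (conv c ?\<kappa>t) (cnj (\<xi> t) * \<phi> (conv c ?\<kappa>))"
      unfolding eq
      by (rule has_mean_scale_translate[OF
            subsetD[OF Cu_subset_bounded_cont conv_character_Cu[OF \<mu> \<nu> \<xi> c]]
            has_mean_conv_character[OF \<mu> \<nu> \<xi> c]])
    then show "mean_fun \<theta> (conv c ?\<kappa>t) = cnj (\<xi> t) * ?m * (LINT t|\<theta>. c t)"
      using mean_fun_eq[OF folner] m[OF c] by simp
  qed
qed

text \<open>On the hull the coefficient is a weakly continuous functional after a convolution that
  is continuous into \<open>Cu_weak\<close>, divided by a constant.\<close>

lemma continuous_map_fourier_bohr: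
  assumes \<mu>: "\<mu> \<in> WAP" and \<xi>: "\<xi> \<in> dual_group"
    and c0: "c0 \<in> Cc" "(LINT t|\<theta>. c0 t) \<noteq> 0"
  shows "continuous_map (subtopology vague_topology (measure_hull \<mu>)) euclidean (fourier_bohr \<theta> \<xi>)"
proof -
  let ?X = "subtopology vague_topology (measure_hull \<mu>)"
  let ?\<psi> = "\<lambda>g. \<phi> (\<lambda>x. cnj (\<xi> x) * g x)"
  have "continuous_map Cu_weak euclidean ?\<psi>"
    by (rule continuous_map_Cu_dual[OF Cu_dual_mult[OF mean_dual character_Cu[OF cnj_character[OF \<xi>]]]])
  then have "continuous_map ?X euclidean (?\<psi> \<circ> conv (\<lambda>s. \<xi> s * c0 s))"
    by (rule continuous_map_compose[OF continuous_map_conv_hull[OF \<mu> times_character_Cc[OF \<xi> c0(1)]]])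
  then have "continuous_map ?X euclidean
      (\<lambda>\<nu>. (?\<psi> \<circ> conv (\<lambda>s. \<xi> s * c0 s)) \<nu> * inverse (LINT t|\<theta>. c0 t))"
    by (rule continuous_map_complex_mult) simp
  moreover have "(?\<psi> \<circ> conv (\<lambda>s. \<xi> s * c0 s)) \<nu> * inverse (LINT t|\<theta>. c0 t) = fourier_bohr \<theta> \<xi> \<nu>"
    if "\<nu> \<in> topspace ?X" for \<nu>
    using that by (simp add: fourier_bohr_eq[OF \<mu> _ \<xi> c0] divide_inverse)
  ultimately show ?thesis
    by (rule continuous_map_eq)
qed

end

lemma mem_measure_hull:
  assumes "\<mu> \<in> radon_measures" shows "\<mu> \<in> measure_hull \<mu>"
proof -
  \<comment> \<open>Off \<open>Cc\<close> both sides agree because Radon measures are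
    extensional.\<close>
  have "translate_meas 0 \<mu> = \<mu>"
    using assms by (auto simp: translate_meas_def radon_measures_def extensional_def fun_eq_iff)
  then have "\<mu> \<in> range (\<lambda>t. translate_meas t \<mu>)"
    by (intro range_eqI[of _ _ 0]) simp
  then have "\<mu> \<in> topspace vague_topology \<inter> range (\<lambda>t. translate_meas t \<mu>)"
    using assms by (simp add: topspace_vague)
  then show ?thesis
    unfolding measure_hull_def by (rule subsetD[OF closure_of_subset_Int])
qed

theorem theorem3p12:
  fixes \<theta> :: "'a::{topological_ab_group_add, t2_space} measure"
    and \<mu> :: "('a \<Rightarrow> complex) \<Rightarrow> complex"
    and \<xi> :: "'a \<Rightarrow> complex"
  assumes "locally_compact_space (euclidean :: 'a topology)"
    and "haar_measure \<theta>"
    and "\<exists>A. folner \<theta> A"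
    and "\<mu> \<in> WAP"
    and "\<xi> \<in> dual_group"
  shows "continuous_map (subtopology vague_topology (measure_hull \<mu>)) euclidean (fourier_bohr \<theta> \<xi>)
    \<and> (\<forall>t. \<forall>\<nu>\<in>measure_hull \<mu>. fourier_bohr \<theta> \<xi> (translate_meas t \<nu>) = cnj (\<xi> t) * fourier_bohr \<theta> \<xi> \<nu>)
    \<and> (fourier_bohr \<theta> \<xi> \<mu> \<noteq> 0 \<longrightarrow>
         continuous_eigenfunction (subtopology vague_topology (measure_hull \<mu>)) translate_meas (fourier_bohr \<theta> \<xi>))"
proof -
  interpret haar \<theta>
    by unfold_locales (fact assms(2))
  obtain A where A: "folner \<theta> A"
    using assms(3) ..
  obtain \<phi> where \<phi>: "limit_mean \<theta> A \<phi>"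
    by (rule limit_mean_exists[of A, OF folner_compact[OF A]])
  interpret folner_mean \<theta> A \<phi>
    by unfold_locales (fact A \<phi>)+
  obtain c0 where c0: "c0 \<in> Cc" "(LINT t|\<theta>. c0 t) \<noteq> 0"
    by (rule exists_nonzero_integral[OF assms(1) folner_compact[OF A, of 0] folner_pos[OF A]])
  have cont: "continuous_map (subtopology vague_topology (measure_hull \<mu>)) euclidean (fourier_bohr \<theta> \<xi>)"
    by (rule continuous_map_fourier_bohr[OF assms(4,5) c0])
  have eigen: "fourier_bohr \<theta> \<xi> (translate_meas t \<nu>) = cnj (\<xi> t) * fourier_bohr \<theta> \<xi> \<nu>"
    if "\<nu> \<in> measure_hull \<mu>" for t \<nu>
    by (rule fourier_bohr_translate[OF assms(4) that assms(5) c0])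
  have "continuous_eigenfunction (subtopology vague_topology (measure_hull \<mu>)) translate_meas (fourier_bohr \<theta> \<xi>)"
    if "fourier_bohr \<theta> \<xi> \<mu> \<noteq> 0"
    unfolding continuous_eigenfunction_def
  proof (intro conjI)
    show "\<exists>\<nu>\<in>topspace (subtopology vague_topology (measure_hull \<mu>)). fourier_bohr \<theta> \<xi> \<nu> \<noteq> 0"
      using that mem_measure_hull[OF WAP_radon[OF assms(4)]] WAP_radon[OF assms(4)]
      by (intro bexI[of _ \<mu>]) (auto simp: topspace_vague)
    \<comment> \<open>The eigencharacter is the conjugate of \<xi>, itself a member of the dual
      group.\<close>
    show "\<exists>\<zeta>\<in>dual_group. \<forall>t. \<forall>\<nu>\<in>topspace (subtopology vague_topology (measure_hull \<mu>)).
        fourier_bohr \<theta> \<xi> (translate_meas t \<nu>) = \<zeta> t * fourier_bohr \<theta> \<xi> \<nu>"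
      using eigen by (intro bexI[OF _ cnj_character[OF assms(5)]]) auto
  qed (rule cont)
  with cont eigen show ?thesis by blast
qed

end
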